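(* Let $b>0$, $0\le\alpha<1$, $\beta>0$, $c>0$, and let $X(\cdot)$ be the CTS-OU process with mean-reversion rate $b$, initial condition $X(0)=X_0$ a.s. and stationary distribution $\mathcal{CTS}(\alpha,\beta,c)$. Then for every $t>0$, with $a=e^{-bt}$, $$X(t)\stackrel{d}{=}X_0e^{-bt}+X_1+X_2,$$ where the three summands are independent, $X_1$ is distributed according to $\mathcal{CTS}\big(\alpha,\beta,c(1-a^\alpha)\big)$, and $$X_2\stackrel{d}{=}\sum_{i=1}^{N_a}\tilde J_i$$ is a compound Poisson random variable, in which $N_a$ is a Poisson random variable with parameter $$\Lambda_a=c\,\Gamma(1-\alpha)\frac{\beta^\alpha}{\alpha}(1-a^\alpha)$$ and the jumps $\tilde J_i$ are i.i.d., independent of $N_a$, and distributed according to the probability density $$f_J(x)=\frac{\alpha}{a^{-\alpha}-1}\int_1^{\frac1a}\frac{(\beta v)^{1-\alpha}x^{-\alpha}e^{-\beta v x}}{\Gamma(1-\alpha)}\,v^{\alpha-1}\,dv,\qquad x>0.$$ For $\alpha=0$ the expressions for $\Lambda_a$ and $f_J$ are understood as their limits for $\alpha\to0^+$.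
   Context: $\mathcal{CTS}(\alpha,\beta,c)$ (classical tempered stable law), with $0\le\alpha<1$, $\beta>0$, $c\geq 0$, denotes the infinitely divisible law on $[0,+\infty)$ without drift and Gaussian part, with Lévy density $\nu(x)=c\,e^{-\beta x}/x^{1+\alpha}$ for $x>0$ and $\nu(x)=0$ for $x<0$; that is, with characteristic function $\exp\left(\int_0^{+\infty}(e^{iux}-1)\,c\,e^{-\beta x}x^{-1-\alpha}dx\right)$ (for $c=0$ it is the law degenerate at $0$). A Lévy-driven Ornstein-Uhlenbeck process with mean-reversion rate $b>0$ is the solution of $dX(t)=-bX(t)\,dt+dL(t)$, $X(0)=X_0$ a.s., where $L(\cdot)$ is a one-dimensional Lévy process (the background driving Lévy process) independent of $X_0$; namely $X(t)=X_0e^{-bt}+\int_0^te^{-b(t-s)}\,dL(s)$. It is called a CTS-OU process with stationary distribution $\mathcal{CTS}(\alpha,\beta,c)$ if $L(\cdot)$ is such that $\mathcal{CTS}(\alpha,\beta,c)$ is the stationary (invariant) law of this equation (the initial condition $X_0$ need not have this law). *)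

theory Defs
  imports "HOL-Probability.Probability"
begin

section \<open>Classical tempered stable laws\<close>

definition cts_levy_density :: "real \<Rightarrow> real \<Rightarrow> real \<Rightarrow> real \<Rightarrow> real" where
  "cts_levy_density \<alpha> \<beta> c x = (if x > 0 then c * exp (- \<beta> * x) / x powr (1 + \<alpha>) else 0)"

text \<open>
  The law is specified by its characteristic function, in the Levy-Khintchine form for a Levy
  measure that integrates \<open>min x 1\<close>, without drift and Gaussian part.
\<close>
definition cts_law :: "real \<Rightarrow> real \<Rightarrow> real \<Rightarrow> real measure \<Rightarrow> bool" where
  "cts_law \<alpha> \<beta> c \<mu> \<longleftrightarrow>
     real_distribution \<mu> \<and>
     (\<forall>u. char \<mu> u =
        exp (CLINT x:{0<..}|lborel.
          (iexp (u * x) - 1) * complex_of_real (cts_levy_density \<alpha> \<beta> c x)))"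

section \<open>Independence and Levy processes\<close>

text \<open>
  The library's \<open>indep_var\<close> forces both variables to take values in the same type; this version
  does not.  It is meant for measurable \<open>X\<close> and \<open>Y\<close>.
\<close>
definition indep_rv ::
  "'w measure \<Rightarrow> 'a measure \<Rightarrow> ('w \<Rightarrow> 'a) \<Rightarrow> 'b measure \<Rightarrow> ('w \<Rightarrow> 'b) \<Rightarrow> bool" where
  "indep_rv M S X T Y \<longleftrightarrow>
     prob_space.indep_set M {X -` A \<inter> space M |A. A \<in> sets S} {Y -` B \<inter> space M |B. B \<in> sets T}"

text \<open>Time is \<open>{0..}\<close>; the values of functions and processes at negative times play no role.\<close>

definition cadlag :: "(real \<Rightarrow> real) \<Rightarrow> bool" where
  "cadlag f \<longleftrightarrow>
     (\<forall>t\<ge>0. (f \<longlongrightarrow> f t) (at_right t)) \<and> (\<forall>t>0. \<exists>l. (f \<longlongrightarrow> l) (at_left t))"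

definition levy_process :: "'w measure \<Rightarrow> (real \<Rightarrow> 'w \<Rightarrow> real) \<Rightarrow> bool" where
  "levy_process M L \<longleftrightarrow>
     prob_space M \<and>
     (\<forall>t\<ge>0. L t \<in> borel_measurable M) \<and>
     (AE w in M. L 0 w = 0) \<and>
     (\<forall>(s :: nat \<Rightarrow> real) n. 0 \<le> s 0 \<longrightarrow> mono s \<longrightarrow>
        prob_space.indep_vars M (\<lambda>_. borel) (\<lambda>i w. L (s (Suc i)) w - L (s i) w) {..<n}) \<and>
     (\<forall>s\<ge>0. \<forall>h\<ge>0. distr M borel (\<lambda>w. L (s + h) w - L s w) = distr M borel (L h)) \<and>
     (\<forall>t\<ge>0. \<forall>\<epsilon>>0.
        ((\<lambda>s. measure M {w \<in> space M. \<bar>L s w - L t w\<bar> > \<epsilon>}) \<longlongrightarrow> 0) (at t within {0..})) \<and>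
     (AE w in M. cadlag (\<lambda>t. L t w))"

section \<open>Levy-driven Ornstein-Uhlenbeck processes\<close>

text \<open>
  Since the noise is additive, the equation \<open>dX(t) = - b X(t) dt + dL(t)\<close> in its integrated form
  involves no stochastic integral and is read path by path.
\<close>
definition ou_solution ::
  "'w measure \<Rightarrow> real \<Rightarrow> (real \<Rightarrow> 'w \<Rightarrow> real) \<Rightarrow> ('w \<Rightarrow> real) \<Rightarrow> (real \<Rightarrow> 'w \<Rightarrow> real) \<Rightarrow> bool" where
  "ou_solution M b L X0 X \<longleftrightarrow>
     (\<forall>t\<ge>0. X t \<in> borel_measurable M) \<and>
     (AE w in M. cadlag (\<lambda>t. X t w)) \<and>
     (AE w in M. X 0 w = X0 w) \<and>
     (AE w in M. \<forall>t\<ge>0.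
        X t w - X 0 w = - b * (LINT s:{0..t}|lborel. X s w) + (L t w - L 0 w))"

definition ou_process ::
  "'w measure \<Rightarrow> real \<Rightarrow> (real \<Rightarrow> 'w \<Rightarrow> real) \<Rightarrow> ('w \<Rightarrow> real) \<Rightarrow> (real \<Rightarrow> 'w \<Rightarrow> real) \<Rightarrow> bool" where
  "ou_process M b L X0 X \<longleftrightarrow>
     levy_process M L \<and>
     X0 \<in> borel_measurable M \<and>
     indep_rv M borel X0 (Pi\<^sub>M {0..} (\<lambda>_. borel)) (\<lambda>w. restrict (\<lambda>t. L t w) {0..}) \<and>
     ou_solution M b L X0 X"

text \<open>
  Invariance of \<open>\<mu>\<close> for the equation driven by \<open>L\<close>: a solution started from an initial value with
  law \<open>\<mu>\<close> that is independent of \<open>L\<close> keeps the law \<open>\<mu>\<close> at all times.  As \<open>M\<close> itself need not carry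
  such an initial value, it is supplied by the first coordinate of \<open>\<mu> \<Otimes>\<^sub>M M\<close>.
\<close>
definition ou_stationary_law ::
  "'w measure \<Rightarrow> real \<Rightarrow> (real \<Rightarrow> 'w \<Rightarrow> real) \<Rightarrow> real measure \<Rightarrow> bool" where
  "ou_stationary_law M b L \<mu> \<longleftrightarrow>
     real_distribution \<mu> \<and>
     (\<forall>X. ou_solution (\<mu> \<Otimes>\<^sub>M M) b (\<lambda>t w. L t (snd w)) fst X \<longrightarrow>
        (\<forall>t\<ge>0. distr (\<mu> \<Otimes>\<^sub>M M) borel (X t) = \<mu>))"

definition cts_ou_process ::
  "'w measure \<Rightarrow> real \<Rightarrow> real \<Rightarrow> real \<Rightarrow> real \<Rightarrow>
   (real \<Rightarrow> 'w \<Rightarrow> real) \<Rightarrow> ('w \<Rightarrow> real) \<Rightarrow> (real \<Rightarrow> 'w \<Rightarrow> real) \<Rightarrow> bool" where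
  "cts_ou_process M b \<alpha> \<beta> c L X0 X \<longleftrightarrow>
     ou_process M b L X0 X \<and> (\<exists>\<mu>. cts_law \<alpha> \<beta> c \<mu> \<and> ou_stationary_law M b L \<mu>)"

section \<open>The compound Poisson component\<close>

definition jump_intensity :: "real \<Rightarrow> real \<Rightarrow> real \<Rightarrow> real \<Rightarrow> real" where
  "jump_intensity \<alpha> \<beta> c a =
     (let \<Lambda> = (\<lambda>\<alpha>. c * Gamma (1 - \<alpha>) * (\<beta> powr \<alpha> / \<alpha>) * (1 - a powr \<alpha>))
      in if \<alpha> = 0 then Lim (at_right 0) \<Lambda> else \<Lambda> \<alpha>)"

definition jump_density :: "real \<Rightarrow> real \<Rightarrow> real \<Rightarrow> real \<Rightarrow> real" where
  "jump_density \<alpha> \<beta> a x =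
     (let f = (\<lambda>\<alpha>. \<alpha> / (a powr (- \<alpha>) - 1) *
            (LINT v:{1..1 / a}|lborel.
               (\<beta> * v) powr (1 - \<alpha>) * x powr (- \<alpha>) * exp (- \<beta> * v * x) / Gamma (1 - \<alpha>)
               * v powr (\<alpha> - 1)))
      in if x \<le> 0 then 0 else if \<alpha> = 0 then Lim (at_right 0) f else f \<alpha>)"

text \<open>A Poisson number of jumps, and i.i.d. jumps with density \<open>f\<close> independent of that number.\<close>
definition compound_poisson_data ::
  "'w measure \<Rightarrow> real \<Rightarrow> (real \<Rightarrow> real) \<Rightarrow> ('w \<Rightarrow> nat) \<Rightarrow> (nat \<Rightarrow> 'w \<Rightarrow> real) \<Rightarrow> bool" where
  "compound_poisson_data N \<Lambda> f K J \<longleftrightarrow>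
     K \<in> measurable N (count_space UNIV) \<and>
     distr N (count_space UNIV) K = measure_pmf (poisson_pmf \<Lambda>) \<and>
     (\<forall>i. distributed N lborel (J i) (\<lambda>x. ennreal (f x))) \<and>
     prob_space.indep_vars N (\<lambda>_. borel) J UNIV \<and>
     indep_rv N (count_space UNIV) K (Pi\<^sub>M UNIV (\<lambda>_. borel)) (\<lambda>w i. J i w)"

text \<open>
  The right-hand side of the decomposition only matters in law, so its ingredients live on a
  probability space \<open>N\<close> of their own; \<open>Y0\<close> is a copy of the initial value, whose law is \<open>\<mu>0\<close>.
  The jumps are indexed from 0.
\<close>
definition cts_ou_summands ::
  "real measure \<Rightarrow> real \<Rightarrow> real \<Rightarrow> real \<Rightarrow> real \<Rightarrow> 'v measure \<Rightarrow>
   ('v \<Rightarrow> real) \<Rightarrow> ('v \<Rightarrow> real) \<Rightarrow> ('v \<Rightarrow> real) \<Rightarrow> ('v \<Rightarrow> nat) \<Rightarrow> (nat \<Rightarrow> 'v \<Rightarrow> real) \<Rightarrow> bool" where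
  "cts_ou_summands \<mu>0 a \<alpha> \<beta> c N Y0 X1 X2 K J \<longleftrightarrow>
     prob_space N \<and>
     Y0 \<in> borel_measurable N \<and> X1 \<in> borel_measurable N \<and> X2 \<in> borel_measurable N \<and>
     prob_space.indep_vars N (\<lambda>_. borel) (\<lambda>i. [\<lambda>w. Y0 w * a, X1, X2] ! i) {..<3} \<and>
     distr N borel Y0 = \<mu>0 \<and>
     cts_law \<alpha> \<beta> (c * (1 - a powr \<alpha>)) (distr N borel X1) \<and>
     compound_poisson_data N (jump_intensity \<alpha> \<beta> c a) (jump_density \<alpha> \<beta> a) K J \<and>
     distr N borel X2 = distr N borel (\<lambda>w. \<Sum>i<K w. J i w)"

end

theory Submission
  imports Defs
begin

text \<open>
  Everything is read off characteristic functions. Write \<open>\<psi>\<^sub>c\<close> for the exponent of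
  \<open>CTS(\<alpha>, \<beta>, c)\<close>, so that the stationary law \<open>\<mu>\<close> has characteristic function \<open>exp \<psi>\<^sub>c\<close>.

  Solving the equation path by path gives \<open>X t = a X\<^sub>0 + Z\<close>, where the noise \<open>Z\<close> is a measurable
  functional of the path of \<open>L\<close> (\<open>ou_path_noise\<close>) and is therefore independent of \<open>X\<^sub>0\<close>. The same
  noise drives the solution started from \<open>\<mu>\<close>, and its law stays \<open>\<mu>\<close>. So \<open>exp (\<psi>\<^sub>c u)\<close> is
  \<open>exp (\<psi>\<^sub>c (a u))\<close> times the characteristic function of \<open>Z\<close>. An exponential never vanishes,
  hence \<open>Z\<close> has the exponent \<open>\<psi>\<^sub>c u - \<psi>\<^sub>c (a u)\<close> whatever the law of \<open>X\<^sub>0\<close> is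
  (\<open>char_ou_process\<close>, \<open>char_ou_stationary_law\<close>).

  It remains to recognise this exponent. Replacing \<open>u\<close> by \<open>a u\<close> turns the Levy density
  \<open>c exp (- \<beta> x) / x\<^sup>1\<^sup>+\<^sup>\<alpha>\<close> into \<open>c a\<^sup>\<alpha> exp (- \<beta> x / a) / x\<^sup>1\<^sup>+\<^sup>\<alpha>\<close>. The difference of the two
  densities is the density of \<open>CTS(\<alpha>, \<beta>, c (1 - a\<^sup>\<alpha>))\<close> plus
  \<open>c a\<^sup>\<alpha> (exp (- \<beta> x) - exp (- \<beta> x / a)) / x\<^sup>1\<^sup>+\<^sup>\<alpha>\<close>. The second term is integrable at \<open>0\<close>, hence
  the Levy density of a compound Poisson law, and its total mass and normalisation are \<open>\<Lambda>\<^sub>a\<close> and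
  \<open>f\<^sub>J\<close> (\<open>jump_levy_density\<close>, \<open>nn_integral_jump_density\<close>, \<open>cts_exponent_decomposition\<close>). By the
  uniqueness theorem for characteristic functions, any realisation of the summands has the law of
  \<open>X t\<close>.

  That a realisation exists requires a law \<open>CTS(\<alpha>, \<beta>, c (1 - a\<^sup>\<alpha>))\<close>. For \<open>\<alpha> = 0\<close> it is
  degenerate at \<open>0\<close>. For \<open>\<alpha> > 0\<close> it comes from \<open>\<mu>\<close> by the same identity with the factor \<open>\<kappa>\<close> given by
  \<open>\<kappa>\<^sup>\<alpha> = 1 - a\<^sup>\<alpha>\<close> instead of \<open>a\<close>: a \<open>\<mu>\<close>-distributed variable scaled by \<open>\<kappa>\<close>, plus an independent
  compound Poisson variable built with \<open>\<kappa>\<close>, is tempered stable with intensity \<open>c \<kappa>\<^sup>\<alpha>\<close>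
  (\<open>cts_law_scaled_intensity\<close>).
\<close>

section \<open>Independence of random variables with different value types\<close>

lemma (in prob_space) indep_set_mono:
  assumes "indep_set A B" "A' \<subseteq> A" "B' \<subseteq> B"
  shows "indep_set A' B'"
  using assms unfolding indep_sets2_eq by blast

lemma (in prob_space) indep_var_iff_indep_rv:
  assumes "X \<in> measurable M S" "Y \<in> measurable M T"
  shows "indep_var S X T Y \<longleftrightarrow> indep_rv M S X T Y"
proof -
  have "Int_stable {X -` D \<inter> space M |D. D \<in> sets S}" for X and S :: "'s measure"
    unfolding Int_stable_def by (auto, rule_tac x="D \<inter> Da" in exI, auto)
  then show ?thesis
    using assms unfolding indep_var_eq indep_rv_def
    by (auto intro: indep_set_sigma_sets indep_set_mono[OF _ sigma_sets_superset_generator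
          sigma_sets_superset_generator])
qed

text \<open>
  Preimages under \<open>f \<circ> X\<close> are preimages under \<open>X\<close>, so composing only shrinks the two families of
  events. This brings independence of a discrete count or of a whole path down to real variables.
\<close>
lemma (in prob_space) indep_rv_compose:
  assumes "indep_rv M S X T Y"
    and X: "X \<in> measurable M S" and Y: "Y \<in> measurable M T"
    and f: "f \<in> measurable S A" and g: "g \<in> measurable T B"
  shows "indep_rv M A (\<lambda>w. f (X w)) B (\<lambda>w. g (Y w))"
proof -
  have sub: "{(\<lambda>w. h (Z w)) -` D \<inter> space M |D. D \<in> sets C} \<subseteq> {Z -` D \<inter> space M |D. D \<in> sets U}"
    if "h \<in> measurable U C" "Z \<in> measurable M U" for h Z C and U :: "'x measure"
  proof safe
    fix D assume "D \<in> sets C"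
    then have "h -` D \<inter> space U \<in> sets U" using that(1) by (rule measurable_sets[rotated])
    moreover have "(\<lambda>w. h (Z w)) -` D \<inter> space M = Z -` (h -` D \<inter> space U) \<inter> space M"
      using measurable_space[OF that(2)] by auto
    ultimately show "\<exists>Da. (\<lambda>w. h (Z w)) -` D \<inter> space M = Z -` Da \<inter> space M \<and> Da \<in> sets U" by blast
  qed
  show ?thesis
    using assms(1) sub[OF f X] sub[OF g Y] unfolding indep_rv_def by (rule indep_set_mono)
qed

section \<open>Characteristic functions of scaled, paired and compound Poisson variables\<close>

lemma char_distr_scale:
  assumes "X \<in> borel_measurable M"
  shows "char (distr M borel (\<lambda>w. X w * a)) u = char (distr M borel X) (a * u)"
  using assms by (simp add: char_def integral_distr mult_ac)

text \<open>
  Splitting according to the number of jumps turns the expectation into \<open>\<Sum>k. P (K = k) * \<phi> ^ k\<close>,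
  where \<open>\<phi>\<close> is the characteristic function of one jump. For a Poisson count this is an exponential
  series.
\<close>
lemma char_compound_poisson:
  assumes "prob_space N" and data: "compound_poisson_data N \<Lambda> f K J" and "\<Lambda> > 0"
  shows "char (distr N borel (\<lambda>w. \<Sum>i<K w. J i w)) u =
           exp (of_real \<Lambda> * (char (density lborel (\<lambda>x. ennreal (f x))) u - 1))"
proof -
  interpret prob_space N by fact
  have K[measurable]: "K \<in> measurable N (count_space UNIV)"
    and law_K: "distr N (count_space UNIV) K = measure_pmf (poisson_pmf \<Lambda>)"
    and law_J: "\<And>i. distributed N lborel (J i) (\<lambda>x. ennreal (f x))"
    and indep_J: "indep_vars (\<lambda>_. borel) J UNIV"
    and indep_KJ: "indep_rv N (count_space UNIV) K (Pi\<^sub>M UNIV (\<lambda>_. borel)) (\<lambda>w i. J i w)"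
    using data unfolding compound_poisson_data_def by auto
  have J[measurable]: "J i \<in> borel_measurable N" for i
    using distributed_measurable[OF law_J[of i]] by simp
  define \<phi> where "\<phi> = char (density lborel (\<lambda>x. ennreal (f x))) u"
  have char_J: "char (distr N borel (J i)) u = \<phi>" for i
    using distributed_distr_eq_density[OF law_J[of i]]
    by (simp add: \<phi>_def cong: distr_cong)
  define S where "S k w = (\<Sum>i<k. J i w)" for k w
  have S[measurable]: "S k \<in> borel_measurable N" for k unfolding S_def by measurable
  have char_S: "(CLINT w|N. iexp (u * S k w)) = \<phi> ^ k" for k
  proof -
    have "char (distr N borel (\<lambda>w. \<Sum>i\<in>{..<k}. J i w)) u = (\<Prod>i<k. \<phi>)"
      using indep_vars_subset[OF indep_J, of "{..<k}"] by (subst char_distr_sum) (auto simp: char_J)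
    then show ?thesis by (simp add: char_def integral_distr S_def)
  qed
  define I where "I k w = (indicator {k} (K w) :: complex)" for k w
  have I[measurable]: "I k \<in> borel_measurable N" for k
    unfolding I_def by (rule measurable_compose[OF K]) simp
  have prob_K: "measure N {w \<in> space N. K w = k} = \<Lambda> ^ k / fact k * exp (- \<Lambda>)" for k
  proof -
    have "measure N {w \<in> space N. K w = k} = measure (distr N (count_space UNIV) K) {k}"
      by (subst measure_distr) (auto intro!: arg_cong[where f="measure N"])
    then show ?thesis using \<open>\<Lambda> > 0\<close> by (simp add: law_K measure_pmf_single)
  qed
  have int_I: "(CLINT w|N. I k w) = of_real (\<Lambda> ^ k / fact k * exp (- \<Lambda>))" for k
  proof -
    have "(CLINT w|N. I k w) = (CLINT w|N. complex_of_real (indicator {w \<in> space N. K w = k} w))"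
      by (intro Bochner_Integration.integral_cong) (auto simp: I_def indicator_def)
    also have "\<dots> = of_real (measure N {w \<in> space N. K w = k})"
      by (subst integral_complex_of_real) simp
    finally show ?thesis by (simp only: prob_K)
  qed
  have int_iexp: "integrable N (\<lambda>w. iexp (u * S k w))" for k
    by (intro integrable_iexp) auto
  have int_II: "integrable N (I k)" for k
    by (rule integrable_const_bound[where B=1]) (auto simp: I_def indicator_def)
  have indep: "indep_var borel (I k) borel (\<lambda>w. iexp (u * S k w))" for k
  proof -
    have "(\<lambda>w i. J i w) \<in> measurable N (Pi\<^sub>M UNIV (\<lambda>_. borel))"
      by (rule measurable_abs_UNIV) simp
    then have "indep_rv N borel (\<lambda>w. indicator {k} (K w) :: complex)
            borel (\<lambda>w. (\<lambda>x :: nat \<Rightarrow> real. iexp (u * (\<Sum>i<k. x i))) (\<lambda>i. J i w))"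
      by (rule indep_rv_compose[OF indep_KJ K]) measurable
    then have "indep_rv N borel (I k) borel (\<lambda>w. iexp (u * S k w))"
      by (simp add: I_def[abs_def] S_def)
    then show ?thesis by (subst indep_var_iff_indep_rv) auto
  qed
  define p where "p k = \<Lambda> ^ k / fact k * exp (- \<Lambda>)" for k
  have term_int: "(CLINT w|N. I k w * iexp (u * S k w)) = of_real (p k) * \<phi> ^ k" for k
    by (subst indep_var_lebesgue_integral[OF indep int_II int_iexp]) (simp only: int_I char_S p_def)
  \<comment> \<open>For each outcome only the term \<open>k = K w\<close> survives, so the series is the integrand split by \<open>K\<close>.\<close>
  have "(\<lambda>k. of_real (p k) * \<phi> ^ k) sums (CLINT w|N. (\<Sum>k. I k w * iexp (u * S k w)))"
    unfolding term_int[symmetric]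
  proof (rule sums_integral)
    show "integrable N (\<lambda>w. I k w * iexp (u * S k w))" for k
      by (rule indep_var_integrable[OF indep int_II int_iexp])
    show "AE w in N. summable (\<lambda>k. norm (I k w * iexp (u * S k w)))"
      by (intro AE_I2 summable_finite[where N="{K _}"]) (auto simp: I_def indicator_def)
    have "(LINT w|N. norm (I k w * iexp (u * S k w))) = p k" for k
    proof -
      have "(LINT w|N. norm (I k w * iexp (u * S k w))) = (LINT w|N. indicator {w \<in> space N. K w = k} w)"
        by (intro Bochner_Integration.integral_cong) (auto simp: I_def indicator_def norm_mult)
      then show ?thesis by (simp add: prob_K p_def)
    qed
    moreover have "summable p"
      unfolding p_def using summable_exp[of \<Lambda>] by (intro summable_mult2) (simp add: field_simps)
    ultimately show "summable (\<lambda>k. LINT w|N. norm (I k w * iexp (u * S k w)))" by simp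
  qed
  also have "(\<lambda>w. \<Sum>k. I k w * iexp (u * S k w)) = (\<lambda>w. iexp (u * (\<Sum>i<K w. J i w)))"
  proof
    fix w
    have "(\<Sum>k. I k w * iexp (u * S k w)) = (\<Sum>k\<in>{K w}. I k w * iexp (u * S k w))"
      by (intro suminf_finite) (auto simp: I_def)
    then show "(\<Sum>k. I k w * iexp (u * S k w)) = iexp (u * (\<Sum>i<K w. J i w))"
      by (simp add: I_def S_def)
  qed
  finally have 1: "(\<lambda>k. of_real (p k) * \<phi> ^ k) sums (CLINT w|N. iexp (u * (\<Sum>i<K w. J i w)))" .
  have "(\<lambda>k. of_real (exp (- \<Lambda>)) * ((of_real \<Lambda> * \<phi>) ^ k /\<^sub>R fact k)) sums
          (of_real (exp (- \<Lambda>)) * exp (of_real \<Lambda> * \<phi>))"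
    by (intro sums_mult exp_converges)
  also have "(\<lambda>k. of_real (exp (- \<Lambda>)) * ((of_real \<Lambda> * \<phi>) ^ k /\<^sub>R fact k)) = (\<lambda>k. of_real (p k) * \<phi> ^ k)"
    by (auto simp: p_def power_mult_distrib scaleR_conv_of_real field_simps)
  finally have 2: "(CLINT w|N. iexp (u * (\<Sum>i<K w. J i w))) = of_real (exp (- \<Lambda>)) * exp (of_real \<Lambda> * \<phi>)"
    using sums_unique2[OF 1] by blast
  have [measurable]: "(\<lambda>w. \<Sum>i<K w. J i w) \<in> borel_measurable N"
    by (rule measurable_compose_countable[where f="\<lambda>k w. \<Sum>i<k. J i w" and g=K]) auto
  have "char (distr N borel (\<lambda>w. \<Sum>i<K w. J i w)) u = (CLINT w|N. iexp (u * (\<Sum>i<K w. J i w)))"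
    by (simp add: char_def integral_distr)
  also have "\<dots> = exp (of_real \<Lambda> * (\<phi> - 1))"
    unfolding 2 exp_of_real[symmetric] mult_exp_exp by (simp add: algebra_simps)
  finally show ?thesis by (simp add: \<phi>_def)
qed

lemma distr_pair_snd:
  assumes "prob_space M" "prob_space N"
  shows "distr (M \<Otimes>\<^sub>M N) N snd = N"
proof (rule measure_eqI)
  interpret M: prob_space M by fact
  interpret N: prob_space N by fact
  fix A assume "A \<in> sets (distr (M \<Otimes>\<^sub>M N) N snd)"
  then have A: "A \<in> sets N" by simp
  then have "snd -` A \<inter> space (M \<Otimes>\<^sub>M N) = space M \<times> A"
    using sets.sets_into_space by (auto simp: space_pair_measure)
  then show "emeasure (distr (M \<Otimes>\<^sub>M N) N snd) A = emeasure N A"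
    using A by (simp add: emeasure_distr N.emeasure_pair_measure_Times M.emeasure_space_1)
qed simp

lemma indep_var_pair_measure:
  assumes M: "prob_space M" and N: "prob_space N"
    and f[measurable]: "f \<in> measurable M S" and g[measurable]: "g \<in> measurable N T"
  shows "prob_space.indep_var (M \<Otimes>\<^sub>M N) S (\<lambda>p. f (fst p)) T (\<lambda>p. g (snd p))"
proof -
  interpret MN: prob_space "M \<Otimes>\<^sub>M N" by (rule prob_space_pair[OF M N])
  interpret N: prob_space N by fact
  have T: "prob_space (distr N T g)" by (rule N.prob_space_distr[OF g])
  have "distr (M \<Otimes>\<^sub>M N) S (\<lambda>p. f (fst p)) = distr M S f"
    using N.distr_pair_fst[of M] by (subst (2) N.distr_pair_fst[symmetric], subst distr_distr) (auto simp: comp_def)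
  moreover have "distr (M \<Otimes>\<^sub>M N) T (\<lambda>p. g (snd p)) = distr N T g"
    by (subst (2) distr_pair_snd[OF M N, symmetric], subst distr_distr) (auto simp: comp_def)
  ultimately show ?thesis
    unfolding MN.indep_var_distribution_eq
    using pair_measure_distr[OF f g prob_space_imp_sigma_finite[OF T]]
    by (simp add: case_prod_unfold)
qed

lemma char_pair_add:
  assumes M: "prob_space M" and N: "prob_space N"
    and f[measurable]: "f \<in> borel_measurable M" and g[measurable]: "g \<in> borel_measurable N"
  shows "char (distr (M \<Otimes>\<^sub>M N) borel (\<lambda>p. f (fst p) + g (snd p))) u =
           char (distr M borel f) u * char (distr N borel g) u"
proof -
  interpret MN: prob_space "M \<Otimes>\<^sub>M N" by (rule prob_space_pair[OF M N])
  interpret N: prob_space N by fact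
  have "distr (M \<Otimes>\<^sub>M N) borel (\<lambda>p. f (fst p)) = distr M borel f"
    using N.distr_pair_fst[of M] by (subst (2) N.distr_pair_fst[symmetric], subst distr_distr) (auto simp: comp_def)
  moreover have "distr (M \<Otimes>\<^sub>M N) borel (\<lambda>p. g (snd p)) = distr N borel g"
    by (subst (2) distr_pair_snd[OF M N, symmetric], subst distr_distr) (auto simp: comp_def)
  ultimately show ?thesis
    using MN.char_distr_add[OF indep_var_pair_measure[OF M N f g]] by simp
qed

section \<open>The characteristic exponent of a tempered stable law\<close>

lemma nn_integral_power_exp:
  assumes s: "s > 0" and \<gamma>: "\<gamma> > (0::real)"
  shows "(\<integral>\<^sup>+x. ennreal (indicator {0<..} x * (x powr (s - 1) * exp (- \<gamma> * x))) \<partial>lborel) =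
           ennreal (Gamma s * \<gamma> powr (- s))"
proof -
  let ?g = "\<lambda>x. indicator {0<..} x * (x powr (s - 1) * exp (- \<gamma> * x))"
  let ?I = "\<integral>\<^sup>+x. ennreal (?g x) \<partial>lborel"
  have "ennreal (Gamma s) =
          ennreal \<gamma> * (\<integral>\<^sup>+x. ennreal (indicator {0..} (0 + \<gamma> * x) * (0 + \<gamma> * x) powr (s - 1) / exp (0 + \<gamma> * x)) \<partial>lborel)"
    unfolding Gamma_conv_nn_integral_real[OF s]
    using \<gamma> by (subst nn_integral_real_affine[where c=\<gamma> and t=0]) auto
  also have "(\<lambda>x. ennreal (indicator {0..} (0 + \<gamma> * x) * (0 + \<gamma> * x) powr (s - 1) / exp (0 + \<gamma> * x))) =
               (\<lambda>x. ennreal (\<gamma> powr (s - 1)) * ennreal (?g x))"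
    using \<gamma> by (auto simp: fun_eq_iff indicator_def powr_mult exp_minus field_simps zero_le_mult_iff
        simp flip: ennreal_mult)
  also have "(\<integral>\<^sup>+x. ennreal (\<gamma> powr (s - 1)) * ennreal (?g x) \<partial>lborel) = ennreal (\<gamma> powr (s - 1)) * ?I"
    by (rule nn_integral_cmult) measurable
  finally have "ennreal (Gamma s) = ennreal (\<gamma> powr s) * ?I"
    using \<gamma> by (simp add: mult.assoc[symmetric] ennreal_mult[symmetric] powr_mult_base)
  then have "ennreal (\<gamma> powr (- s)) * ennreal (Gamma s) = ennreal (\<gamma> powr (- s)) * ennreal (\<gamma> powr s) * ?I"
    by (simp add: mult.assoc)
  then show ?thesis
    using \<gamma> s by (simp add: ennreal_mult[symmetric] powr_add[symmetric] mult.commute)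
qed

lemma integrable_power_exp:
  assumes "\<alpha> < 1" "\<gamma> > (0::real)"
  shows "integrable lborel (\<lambda>x. indicator {0<..} x * (x powr (- \<alpha>) * exp (- \<gamma> * x)))"
proof (rule integrableI_nonneg)
  show "(\<integral>\<^sup>+x. ennreal (indicator {0<..} x * (x powr (- \<alpha>) * exp (- \<gamma> * x))) \<partial>lborel) < \<infinity>"
    using nn_integral_power_exp[of "1 - \<alpha>" \<gamma>] assms by simp
qed auto

definition cts_exponent :: "real \<Rightarrow> real \<Rightarrow> real \<Rightarrow> real \<Rightarrow> complex" where
  "cts_exponent \<alpha> \<beta> c u =
     (CLINT x:{0<..}|lborel. (iexp (u * x) - 1) * complex_of_real (cts_levy_density \<alpha> \<beta> c x))"

lemma cts_law_iff:
  "cts_law \<alpha> \<beta> c \<mu> \<longleftrightarrow> real_distribution \<mu> \<and> (\<forall>u. char \<mu> u = exp (cts_exponent \<alpha> \<beta> c u))"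
  by (simp add: cts_law_def cts_exponent_def)

lemma cts_levy_density_measurable[measurable]: "cts_levy_density \<alpha> \<beta> c \<in> borel_measurable borel"
  unfolding cts_levy_density_def by measurable

text \<open>
  The Levy density may have infinite mass at \<open>0\<close>. The factor \<open>iexp (u * x) - 1\<close>, of modulus at
  most \<open>\<bar>u * x\<bar>\<close>, removes one power of \<open>x\<close>, and what is left is dominated by a multiple of a Gamma
  density.
\<close>
lemma cts_exponent_integrable:
  assumes "\<alpha> < 1" "\<beta> > 0"
  shows "set_integrable lborel {0<..}
           (\<lambda>x. (iexp (u * x) - 1) * complex_of_real (cts_levy_density \<alpha> \<beta> c x))"
  unfolding set_integrable_def
proof (rule Bochner_Integration.integrable_bound)
  show "integrable lborel (\<lambda>x. (\<bar>u\<bar> * \<bar>c\<bar>) * (indicator {0<..} x * (x powr (- \<alpha>) * exp (- \<beta> * x))))"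
    by (intro integrable_mult_right integrable_power_exp assms)
  have "cmod ((iexp (u * x) - 1) * complex_of_real (cts_levy_density \<alpha> \<beta> c x))
          \<le> \<bar>u\<bar> * \<bar>c\<bar> * (x powr (- \<alpha>) * exp (- \<beta> * x))" if "x > 0" for x
  proof -
    have "cmod (iexp (u * x) - 1) \<le> \<bar>u * x\<bar>" using iexp_approx1[of "u * x" 0] by simp
    then have "cmod (iexp (u * x) - 1) * \<bar>cts_levy_density \<alpha> \<beta> c x\<bar> \<le> \<bar>u * x\<bar> * \<bar>cts_levy_density \<alpha> \<beta> c x\<bar>"
      by (intro mult_right_mono) auto
    also have "\<dots> = \<bar>u\<bar> * \<bar>c\<bar> * (x powr (- \<alpha>) * exp (- \<beta> * x))"
      using that by (simp add: cts_levy_density_def abs_mult powr_add powr_minus field_simps)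
    finally show ?thesis by (simp add: norm_mult)
  qed
  then show "AE x in lborel. norm (indicat_real {0<..} x *\<^sub>R
      ((iexp (u * x) - 1) * complex_of_real (cts_levy_density \<alpha> \<beta> c x)))
      \<le> norm (\<bar>u\<bar> * \<bar>c\<bar> * (indicator {0<..} x * (x powr (- \<alpha>) * exp (- \<beta> * x))))"
    by (intro AE_I2) (auto simp: indicator_def abs_mult)
qed measurable

lemma cts_exponent_add:
  assumes "\<alpha> < 1" "\<beta> > 0"
  shows "cts_exponent \<alpha> \<beta> (c + d) u = cts_exponent \<alpha> \<beta> c u + cts_exponent \<alpha> \<beta> d u"
proof -
  have "cts_levy_density \<alpha> \<beta> (c + d) x = cts_levy_density \<alpha> \<beta> c x + cts_levy_density \<alpha> \<beta> d x" for x
    by (simp add: cts_levy_density_def algebra_simps add_divide_distrib)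
  then show ?thesis
    unfolding cts_exponent_def
    by (subst set_integral_add(2)[OF cts_exponent_integrable cts_exponent_integrable, symmetric])
       (auto simp: assms algebra_simps)
qed

text \<open>
  Scaling a tempered stable variable by \<open>a\<close> changes its tempering and its intensity, but not its
  index.
\<close>
lemma cts_exponent_scale:
  assumes "a > 0"
  shows "cts_exponent \<alpha> \<beta> c (a * u) = cts_exponent \<alpha> (\<beta> / a) (c * a powr \<alpha>) u"
proof -
  have eq: "a * cts_levy_density \<alpha> (\<beta> / a) (c * a powr \<alpha>) (a * x) = cts_levy_density \<alpha> \<beta> c x" for x
    using assms by (auto simp: cts_levy_density_def zero_less_mult_iff powr_mult powr_add field_simps)
  have "cts_exponent \<alpha> (\<beta> / a) (c * a powr \<alpha>) u =
          \<bar>a\<bar> *\<^sub>R (CLINT x|lborel. indicator {0<..} (0 + a * x) *\<^sub>R ((iexp (u * (0 + a * x)) - 1) *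
             complex_of_real (cts_levy_density \<alpha> (\<beta> / a) (c * a powr \<alpha>) (0 + a * x))))"
    unfolding cts_exponent_def set_lebesgue_integral_def
    using assms by (subst lborel_integral_real_affine[where c=a and t=0]) auto
  also have "\<dots> = cts_exponent \<alpha> \<beta> c (a * u)"
    unfolding cts_exponent_def set_lebesgue_integral_def integral_scaleR_right[symmetric]
    using assms
    by (intro Bochner_Integration.integral_cong)
       (auto simp: indicator_def zero_less_mult_iff eq[symmetric] scaleR_conv_of_real algebra_simps)
  finally show ?thesis ..
qed

section \<open>The compound Poisson part\<close>

text \<open>
  This is the integral of \<open>v powr (\<alpha> - 1)\<close> over \<open>{1..1 / a}\<close>. The jump density is a mixture over
  \<open>v\<close> in that interval of Gamma densities with rate \<open>\<beta> * v\<close>, and the integral normalises the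
  mixing weights.
\<close>
definition tempering_range :: "real \<Rightarrow> real \<Rightarrow> real" where
  "tempering_range \<alpha> a = (if \<alpha> = 0 then - ln a else (a powr (- \<alpha>) - 1) / \<alpha>)"

lemma tempering_range_pos:
  assumes "0 < a" "a < 1" "0 \<le> \<alpha>"
  shows "tempering_range \<alpha> a > 0"
  using assms by (auto simp: tempering_range_def powr_minus powr01_less_one field_simps ln_less_zero_iff)

text \<open>
  The difference quotient of \<open>s \<mapsto> a powr (- s)\<close> at \<open>0\<close>. Both limits for \<open>\<alpha> \<rightarrow> 0\<close> rest on it,
  since the other factors are continuous there.
\<close>
lemma tempering_range_tendsto:
  assumes "0 < a"
  shows "((\<lambda>s. tempering_range s a) \<longlongrightarrow> tempering_range 0 a) (at_right 0)"
proof -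
  have "((\<lambda>s. a powr (- s)) has_real_derivative - ln a) (at 0)"
    using assms by (auto intro!: derivative_eq_intros)
  then have "(\<lambda>h. (a powr (- h) - 1) / h) \<midarrow>0\<rightarrow> - ln a"
    using assms by (simp add: DERIV_def)
  then have "((\<lambda>h. (a powr (- h) - 1) / h) \<longlongrightarrow> - ln a) (at_right 0)"
    by (rule filterlim_mono) (auto simp: at_le)
  then have "((\<lambda>h. (a powr (- h) - 1) / h) \<longlongrightarrow> tempering_range 0 a) (at_right 0)"
    by (simp add: tempering_range_def)
  then show ?thesis
    by (rule Lim_transform_eventually)
       (auto simp: tempering_range_def eventually_at_right_field intro!: exI[of _ 1])
qed

lemma jump_intensity_eq:
  assumes "0 < a" "\<alpha> \<ge> 0" "\<beta> > 0"
  shows "jump_intensity \<alpha> \<beta> c a = c * Gamma (1 - \<alpha>) * \<beta> powr \<alpha> * a powr \<alpha> * tempering_range \<alpha> a"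
proof -
  let ?R = "\<lambda>s. c * Gamma (1 - s) * \<beta> powr s * a powr s * tempering_range s a"
  have eq: "c * Gamma (1 - s) * (\<beta> powr s / s) * (1 - a powr s) = ?R s" if "s > 0" for s
    using that assms by (simp add: tempering_range_def powr_minus field_simps)
  show ?thesis
  proof (cases "\<alpha> = 0")
    case True
    have "(?R \<longlongrightarrow> ?R 0) (at_right 0)"
      using assms by (intro tendsto_intros tempering_range_tendsto tendsto_Gamma) (auto intro!: tendsto_eq_intros)
    then have "((\<lambda>s. c * Gamma (1 - s) * (\<beta> powr s / s) * (1 - a powr s)) \<longlongrightarrow> ?R 0) (at_right 0)"
      by (rule Lim_transform_eventually)
         (rule eventually_mono[OF eventually_at_right_less], simp only: eq)
    then show ?thesis
      unfolding jump_intensity_def Let_def using True by (simp add: tendsto_Lim)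
  next
    case False
    then show ?thesis using eq[of \<alpha>] assms by (simp add: jump_intensity_def)
  qed
qed

lemma tempering_difference:
  fixes a \<beta> x :: real
  assumes "0 < a" "a < 1" "\<beta> > 0" "x > 0"
  shows "(LINT v:{1..1 / a}|lborel. \<beta> * exp (- \<beta> * v * x)) = (exp (- \<beta> * x) - exp (- (\<beta> / a) * x)) / x"
proof -
  have "(LINT v|lborel. indicator {1..1 / a} v *\<^sub>R (\<beta> * exp (- \<beta> * v * x))) =
          - exp (- \<beta> * (1 / a) * x) / x - - exp (- \<beta> * 1 * x) / x"
    using assms
    by (intro integral_FTC_atLeastAtMost[where F="\<lambda>v. - exp (- \<beta> * v * x) / x"])
       (auto intro!: derivative_eq_intros continuous_intros simp flip: has_real_derivative_iff_has_vector_derivative)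
  then show ?thesis unfolding set_lebesgue_integral_def by (simp add: diff_divide_distrib)
qed

text \<open>
  In the mixture the powers of \<open>v\<close> cancel, so that the integral over \<open>v\<close> is that of a pure
  exponential. The resulting closed form also covers the limiting case \<open>\<alpha> = 0\<close>.
\<close>
lemma jump_density_eq:
  assumes a: "0 < a" "a < 1" and "0 \<le> \<alpha>" "\<alpha> < 1" "\<beta> > 0" "x > 0"
  shows "jump_density \<alpha> \<beta> a x =
           x powr (- \<alpha>) * ((exp (- \<beta> * x) - exp (- (\<beta> / a) * x)) / x) /
           (Gamma (1 - \<alpha>) * \<beta> powr \<alpha> * tempering_range \<alpha> a)"
proof -
  let ?R = "\<lambda>s. x powr (- s) * ((exp (- \<beta> * x) - exp (- (\<beta> / a) * x)) / x) /
              (Gamma (1 - s) * \<beta> powr s * tempering_range s a)"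
  let ?F = "\<lambda>s. s / (a powr (- s) - 1) * (LINT v:{1..1 / a}|lborel.
               (\<beta> * v) powr (1 - s) * x powr (- s) * exp (- \<beta> * v * x) / Gamma (1 - s) * v powr (s - 1))"
  have eq: "?F s = ?R s" if "s > 0" "s < 1" for s
  proof -
    have "(LINT v:{1..1 / a}|lborel.
             (\<beta> * v) powr (1 - s) * x powr (- s) * exp (- \<beta> * v * x) / Gamma (1 - s) * v powr (s - 1)) =
          (LINT v:{1..1 / a}|lborel.
             (x powr (- s) / (Gamma (1 - s) * \<beta> powr s)) * (\<beta> * exp (- \<beta> * v * x)))"
    proof (rule set_lebesgue_integral_cong)
      show "\<forall>v. v \<in> {1..1 / a} \<longrightarrow>
         (\<beta> * v) powr (1 - s) * x powr (- s) * exp (- \<beta> * v * x) / Gamma (1 - s) * v powr (s - 1) =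
          (x powr (- s) / (Gamma (1 - s) * \<beta> powr s)) * (\<beta> * exp (- \<beta> * v * x))"
        using assms by (auto simp: powr_mult powr_diff field_simps)
    qed simp
    also have "\<dots> = x powr (- s) / (Gamma (1 - s) * \<beta> powr s) * ((exp (- \<beta> * x) - exp (- (\<beta> / a) * x)) / x)"
      unfolding set_integral_mult_right using tempering_difference[of a \<beta> x] assms by simp
    finally have int_eq: "(LINT v:{1..1 / a}|lborel.
             (\<beta> * v) powr (1 - s) * x powr (- s) * exp (- \<beta> * v * x) / Gamma (1 - s) * v powr (s - 1)) =
          x powr (- s) / (Gamma (1 - s) * \<beta> powr s) * ((exp (- \<beta> * x) - exp (- (\<beta> / a) * x)) / x)" .
    show ?thesis
      unfolding int_eq using that by (simp add: tempering_range_def mult_ac)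
  qed
  show ?thesis
  proof (cases "\<alpha> = 0")
    case True
    have "(?R \<longlongrightarrow> ?R 0) (at_right 0)"
      using assms tempering_range_pos[of a 0]
      by (intro tendsto_intros tempering_range_tendsto tendsto_Gamma) (auto intro!: tendsto_eq_intros)
    then have "(?F \<longlongrightarrow> ?R 0) (at_right 0)"
      by (rule Lim_transform_eventually)
         (rule eventually_mono[OF eventually_at_right_real[of 0 1]],
          simp, simp only: eq greaterThanLessThan_iff)
    then show ?thesis
      unfolding jump_density_def Let_def using True \<open>x > 0\<close> by (simp add: tendsto_Lim)
  next
    case False
    then show ?thesis using eq[of \<alpha>] assms by (simp add: jump_density_def)
  qed
qed

lemma jump_density_nonpos: "x \<le> 0 \<Longrightarrow> jump_density \<alpha> \<beta> a x = 0"
  by (simp add: jump_density_def)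

lemma jump_density_nonneg:
  assumes "0 < a" "a < 1" "0 \<le> \<alpha>" "\<alpha> < 1" "\<beta> > 0"
  shows "jump_density \<alpha> \<beta> a x \<ge> 0"
proof (cases "x > 0")
  case True
  have "\<beta> * x \<le> \<beta> / a * x" using assms True by (simp add: field_simps)
  then show ?thesis
    using assms True tempering_range_pos[of a \<alpha>] Gamma_real_pos[of "1 - \<alpha>"]
    by (simp add: jump_density_eq)
qed (simp add: jump_density_nonpos)

lemma jump_intensity_pos:
  assumes "0 < a" "a < 1" "0 \<le> \<alpha>" "\<alpha> < 1" "\<beta> > 0" "c > 0"
  shows "jump_intensity \<alpha> \<beta> c a > 0"
  using assms tempering_range_pos[of a \<alpha>] Gamma_real_pos[of "1 - \<alpha>"] by (simp add: jump_intensity_eq)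

text \<open>
  The constants in the intensity and in the density cancel, and a difference of two tempered
  stable Levy densities with the same behaviour at \<open>0\<close> remains.
\<close>
lemma jump_levy_density:
  assumes "0 < a" "a < 1" "0 \<le> \<alpha>" "\<alpha> < 1" "\<beta> > 0"
  shows "jump_intensity \<alpha> \<beta> c a * jump_density \<alpha> \<beta> a x =
           cts_levy_density \<alpha> \<beta> (c * a powr \<alpha>) x - cts_levy_density \<alpha> (\<beta> / a) (c * a powr \<alpha>) x"
proof -
  have "Gamma (1 - \<alpha>) > 0" using assms by (intro Gamma_real_pos) simp
  moreover have "tempering_range \<alpha> a > 0" using assms by (intro tempering_range_pos)
  ultimately have "Gamma (1 - \<alpha>) \<noteq> 0" "tempering_range \<alpha> a \<noteq> 0" by linarith+
  with assms show ?thesis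
    by (cases "x > 0")
       (simp_all add: jump_intensity_eq jump_density_eq jump_density_nonpos cts_levy_density_def
        powr_add powr_minus field_simps)
qed

lemma jump_density_measurable:
  assumes "0 < a" "a < 1" "0 \<le> \<alpha>" "\<alpha> < 1" "\<beta> > 0"
  shows "jump_density \<alpha> \<beta> a \<in> borel_measurable borel"
proof -
  have "jump_density \<alpha> \<beta> a = (\<lambda>x. (cts_levy_density \<alpha> \<beta> (1 * a powr \<alpha>) x -
          cts_levy_density \<alpha> (\<beta> / a) (1 * a powr \<alpha>) x) / jump_intensity \<alpha> \<beta> 1 a)"
    using jump_intensity_pos[OF assms, of 1]
    by (simp only: jump_levy_density[OF assms, symmetric]) (simp add: fun_eq_iff)
  then show ?thesis by simp
qed

text \<open>
  By Tonelli, integrate over \<open>x\<close> before integrating over the mixing parameter \<open>v\<close>: the inner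
  integral is a Gamma integral, the outer one the integral of \<open>v powr (\<alpha> - 1)\<close>. For \<open>\<alpha> = 0\<close> this
  is Frullani's integral.
\<close>
lemma nn_integral_jump_density:
  assumes a: "0 < a" "a < 1" and "0 \<le> \<alpha>" "\<alpha> < 1" "\<beta> > 0"
  shows "(\<integral>\<^sup>+x. ennreal (jump_density \<alpha> \<beta> a x) \<partial>lborel) = 1"
proof -
  define C where "C = Gamma (1 - \<alpha>) * \<beta> powr \<alpha> * tempering_range \<alpha> a"
  have C: "C > 0"
    using assms tempering_range_pos[of a \<alpha>] Gamma_real_pos[of "1 - \<alpha>"] by (simp add: C_def)
  define k where "k x v = indicator {0<..} x * (x powr (- \<alpha>) * exp (- (\<beta> * v) * x))" for x v :: real
  have k[measurable]: "(\<lambda>(x, v). k x v) \<in> borel_measurable (borel \<Otimes>\<^sub>M borel)"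
    unfolding k_def by measurable
  have inner_v: "(\<integral>\<^sup>+v. ennreal (indicator {1..1 / a} v * (\<beta> * k x v)) \<partial>lborel) =
                   ennreal (C * jump_density \<alpha> \<beta> a x)" for x
  proof (cases "x > 0")
    case True
    have "(\<integral>\<^sup>+v. ennreal (indicator {1..1 / a} v * (\<beta> * k x v)) \<partial>lborel) =
            (\<integral>\<^sup>+v. ennreal (x powr (- \<alpha>)) * (ennreal (\<beta> * exp (- \<beta> * v * x)) * indicator {1..1 / a} v) \<partial>lborel)"
      using True assms by (intro nn_integral_cong) (auto simp: k_def indicator_def field_simps simp flip: ennreal_mult)
    also have "\<dots> = ennreal (x powr (- \<alpha>)) * (\<integral>\<^sup>+v. ennreal (\<beta> * exp (- \<beta> * v * x)) * indicator {1..1 / a} v \<partial>lborel)"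
      by (rule nn_integral_cmult) measurable
    also have "(\<integral>\<^sup>+v. ennreal (\<beta> * exp (- \<beta> * v * x)) * indicator {1..1 / a} v \<partial>lborel) =
                 ennreal (- exp (- \<beta> * (1 / a) * x) / x - - exp (- \<beta> * 1 * x) / x)"
      using assms True by (intro nn_integral_FTC_Icc) (auto intro!: derivative_eq_intros)
    finally show ?thesis
      using assms True C
      by (simp add: jump_density_eq C_def[symmetric] ennreal_mult'[symmetric] diff_divide_distrib)
  next
    case False
    then show ?thesis by (simp add: k_def jump_density_nonpos)
  qed
  have inner_x: "(\<integral>\<^sup>+x. ennreal (indicator {1..1 / a} v * (\<beta> * k x v)) \<partial>lborel) =
                   ennreal (Gamma (1 - \<alpha>) * \<beta> powr \<alpha> * v powr (\<alpha> - 1)) * indicator {1..1 / a} v" for v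
  proof (cases "v \<in> {1..1 / a}")
    case True
    then have "v > 0" by auto
    have "(\<integral>\<^sup>+x. ennreal (indicator {1..1 / a} v * (\<beta> * k x v)) \<partial>lborel) = (\<integral>\<^sup>+x. ennreal \<beta> * ennreal (k x v) \<partial>lborel)"
      using True assms by (simp add: ennreal_mult' k_def)
    also have "\<dots> = ennreal \<beta> * ennreal (Gamma (1 - \<alpha>) * (\<beta> * v) powr (- (1 - \<alpha>)))"
      using nn_integral_power_exp[of "1 - \<alpha>" "\<beta> * v"] assms \<open>v > 0\<close>
      by (subst nn_integral_cmult) (simp_all add: k_def)
    finally show ?thesis
      using True assms \<open>v > 0\<close>
      by (simp add: ennreal_mult'[symmetric] powr_mult powr_diff field_simps)
  qed simp
  have "(\<integral>\<^sup>+x. ennreal (C * jump_density \<alpha> \<beta> a x) \<partial>lborel) =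
          (\<integral>\<^sup>+x. \<integral>\<^sup>+v. ennreal (indicator {1..1 / a} v * (\<beta> * k x v)) \<partial>lborel \<partial>lborel)"
    by (simp add: inner_v)
  also have "\<dots> = (\<integral>\<^sup>+v. \<integral>\<^sup>+x. ennreal (indicator {1..1 / a} v * (\<beta> * k x v)) \<partial>lborel \<partial>lborel)"
    by (rule lborel_pair.Fubini') measurable
  also have "\<dots> = (\<integral>\<^sup>+v. ennreal (Gamma (1 - \<alpha>) * \<beta> powr \<alpha> * v powr (\<alpha> - 1)) * indicator {1..1 / a} v \<partial>lborel)"
    by (simp add: inner_x)
  also have "\<dots> = ennreal C"
  proof -
    \<comment> \<open>A primitive of \<open>v powr (\<alpha> - 1)\<close>, up to the constant factor.\<close>
    define F where "F v = Gamma (1 - \<alpha>) * \<beta> powr \<alpha> * (if \<alpha> = 0 then ln v else v powr \<alpha> / \<alpha>)" for v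
    have "(\<integral>\<^sup>+v. ennreal (Gamma (1 - \<alpha>) * \<beta> powr \<alpha> * v powr (\<alpha> - 1)) * indicator {1..1 / a} v \<partial>lborel) =
            ennreal (F (1 / a) - F 1)"
    proof (rule nn_integral_FTC_Icc)
      fix v :: real assume v: "v \<in> {1..1 / a}"
      then show "DERIV F v :> Gamma (1 - \<alpha>) * \<beta> powr \<alpha> * v powr (\<alpha> - 1)"
        unfolding F_def
        by (cases "\<alpha> = 0") (auto intro!: derivative_eq_intros simp: powr_minus divide_inverse)
    qed (use assms in \<open>auto intro!: mult_nonneg_nonneg Gamma_real_nonneg\<close>)
    also have "F (1 / a) - F 1 = C"
      using a by (auto simp: F_def C_def tempering_range_def ln_div powr_divide powr_minus field_simps)
    finally show ?thesis .
  qed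
  finally have "ennreal C = (\<integral>\<^sup>+x. ennreal C * ennreal (jump_density \<alpha> \<beta> a x) \<partial>lborel)"
    using C jump_density_nonneg[OF assms] by (simp add: ennreal_mult)
  also have "\<dots> = ennreal C * (\<integral>\<^sup>+x. ennreal (jump_density \<alpha> \<beta> a x) \<partial>lborel)"
    using jump_density_measurable[OF assms] by (intro nn_integral_cmult) simp
  finally show ?thesis
    using C by (metis ennreal_mult_cancel_left ennreal_eq_0_iff ennreal_neq_top not_le mult.right_neutral)
qed

text \<open>
  As \<open>jump_density\<close> has total mass 1, the subtracted 1 can be moved under the integral, which
  becomes a difference of two tempered stable exponents.
\<close>
lemma char_jump_density:
  assumes "0 < a" "a < 1" "0 \<le> \<alpha>" "\<alpha> < 1" "\<beta> > 0"
  shows "of_real (jump_intensity \<alpha> \<beta> c a) *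
           (char (density lborel (\<lambda>x. ennreal (jump_density \<alpha> \<beta> a x))) u - 1) =
         cts_exponent \<alpha> \<beta> (c * a powr \<alpha>) u - cts_exponent \<alpha> (\<beta> / a) (c * a powr \<alpha>) u"
proof -
  let ?f = "jump_density \<alpha> \<beta> a"
  note [measurable] = jump_density_measurable[OF assms]
  have nonneg: "?f x \<ge> 0" for x by (rule jump_density_nonneg[OF assms])
  have f: "integrable lborel ?f" and f1: "integral\<^sup>L lborel ?f = 1"
    using nn_integral_jump_density[OF assms] nonneg
    by (auto intro!: integrableI_nonneg simp: integral_eq_nn_integral)
  have intf: "integrable lborel (\<lambda>x. ?f x *\<^sub>R iexp (u * x))"
    by (rule Bochner_Integration.integrable_bound[OF f]) (auto simp: nonneg)
  have "char (density lborel (\<lambda>x. ennreal (?f x))) u - 1 =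
          (CLINT x|lborel. ?f x *\<^sub>R iexp (u * x)) - (CLINT x|lborel. complex_of_real (?f x))"
    unfolding char_def using nonneg by (subst integral_density) (auto simp: f1)
  also have "\<dots> = (CLINT x|lborel. ?f x *\<^sub>R iexp (u * x) - complex_of_real (?f x))"
    using f by (intro Bochner_Integration.integral_diff[symmetric] intf) simp
  finally have "of_real (jump_intensity \<alpha> \<beta> c a) *
           (char (density lborel (\<lambda>x. ennreal (?f x))) u - 1) =
        (CLINT x|lborel. of_real (jump_intensity \<alpha> \<beta> c a) * (?f x *\<^sub>R iexp (u * x) - complex_of_real (?f x)))"
    by simp
  also have "\<dots> = (CLINT x:{0<..}|lborel.
         (iexp (u * x) - 1) * complex_of_real (cts_levy_density \<alpha> \<beta> (c * a powr \<alpha>) x)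
       - (iexp (u * x) - 1) * complex_of_real (cts_levy_density \<alpha> (\<beta> / a) (c * a powr \<alpha>) x))"
    unfolding set_lebesgue_integral_def
  proof (intro Bochner_Integration.integral_cong refl)
    fix x
    have "of_real (jump_intensity \<alpha> \<beta> c a) * (?f x *\<^sub>R iexp (u * x) - complex_of_real (?f x)) =
            (iexp (u * x) - 1) * of_real (jump_intensity \<alpha> \<beta> c a * ?f x)"
      by (simp add: scaleR_conv_of_real algebra_simps)
    also have "\<dots> = indicator {0<..} x *\<^sub>R ((iexp (u * x) - 1) * of_real (jump_intensity \<alpha> \<beta> c a * ?f x))"
      by (simp add: indicator_def jump_density_nonpos)
    finally show "of_real (jump_intensity \<alpha> \<beta> c a) * (?f x *\<^sub>R iexp (u * x) - complex_of_real (?f x)) =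
        indicat_real {0<..} x *\<^sub>R
         ((iexp (u * x) - 1) * complex_of_real (cts_levy_density \<alpha> \<beta> (c * a powr \<alpha>) x) -
          (iexp (u * x) - 1) * complex_of_real (cts_levy_density \<alpha> (\<beta> / a) (c * a powr \<alpha>) x))"
      by (simp only: jump_levy_density[OF assms] of_real_diff right_diff_distrib)
  qed
  also have "\<dots> = cts_exponent \<alpha> \<beta> (c * a powr \<alpha>) u - cts_exponent \<alpha> (\<beta> / a) (c * a powr \<alpha>) u"
    unfolding cts_exponent_def using assms by (intro set_integral_diff cts_exponent_integrable) auto
  finally show ?thesis .
qed

text \<open>
  The selfdecomposability identity behind the theorem: the jumps counted by
  \<open>CTS(\<alpha>, \<beta>, c a\<^sup>\<alpha>)\<close> but not by \<open>a\<close> times \<open>CTS(\<alpha>, \<beta>, c)\<close> form a compound Poisson part. It is used for the given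
  factor \<open>a\<close>, and once more with a different factor to construct tempered stable laws.
\<close>
lemma cts_exponent_decomposition:
  assumes "0 < a" "a < 1" "0 \<le> \<alpha>" "\<alpha> < 1" "\<beta> > 0"
  shows "cts_exponent \<alpha> \<beta> (c * a powr \<alpha>) u =
           cts_exponent \<alpha> \<beta> c (a * u) + of_real (jump_intensity \<alpha> \<beta> c a) *
             (char (density lborel (\<lambda>x. ennreal (jump_density \<alpha> \<beta> a x))) u - 1)"
  unfolding char_jump_density[OF assms] using assms by (simp add: cts_exponent_scale)

section \<open>Cadlag paths\<close>

text \<open>
  One-sided limits make the path bounded near each point, and the Bolzano bisection principle
  patches these local bounds together.
\<close>
lemma cadlag_bounded:
  assumes "cadlag f" "0 \<le> t"
  shows "\<exists>B. \<forall>s\<in>{0..t}. \<bar>f s\<bar> \<le> B"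
proof -
  \<comment> \<open>The guard \<open>0 \<le> s\<close> is there because bisection also visits intervals that reach below \<open>0\<close>.\<close>
  define P where "P a b \<longleftrightarrow> (\<exists>B. \<forall>s\<in>{a..b}. 0 \<le> s \<longrightarrow> \<bar>f s\<bar> \<le> B)" for a b
  have "P 0 t"
  proof (rule Bolzano)
    show "P a c" if ab: "P a b" and bc: "P b c" for a b c
    proof -
      obtain B B' where "\<forall>s\<in>{a..b}. 0 \<le> s \<longrightarrow> \<bar>f s\<bar> \<le> B" "\<forall>s\<in>{b..c}. 0 \<le> s \<longrightarrow> \<bar>f s\<bar> \<le> B'"
        using ab bc unfolding P_def by blast
      then have "\<forall>s\<in>{a..c}. 0 \<le> s \<longrightarrow> \<bar>f s\<bar> \<le> max B B'"
        by (auto simp: le_max_iff_disj)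
      then show "P a c" unfolding P_def by blast
    qed
  next
    fix x assume x: "0 \<le> x" "x \<le> t"
    have "\<forall>\<^sub>F s in at_right x. \<bar>f s\<bar> < \<bar>f x\<bar> + 1"
      using assms(1) x(1) unfolding cadlag_def
      by (intro order_tendstoD(2)[OF tendsto_rabs]) auto
    then obtain r where r: "r > x" "\<And>s. x < s \<Longrightarrow> s < r \<Longrightarrow> \<bar>f s\<bar> < \<bar>f x\<bar> + 1"
      unfolding eventually_at_right_field by blast
    obtain l B where l: "l < x" "\<And>s. l < s \<Longrightarrow> s < x \<Longrightarrow> 0 \<le> s \<Longrightarrow> \<bar>f s\<bar> \<le> B"
    proof (cases "x = 0")
      case True
      then show ?thesis using that[of "-1" 0] by auto
    next
      case False
      then obtain y where "(f \<longlongrightarrow> y) (at_left x)"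
        using assms(1) x(1) unfolding cadlag_def by (metis order_le_less)
      then have "\<forall>\<^sub>F s in at_left x. \<bar>f s\<bar> < \<bar>y\<bar> + 1"
        by (intro order_tendstoD(2)[OF tendsto_rabs]) auto
      then obtain l where "l < x" "\<And>s. l < s \<Longrightarrow> s < x \<Longrightarrow> \<bar>f s\<bar> < \<bar>y\<bar> + 1"
        unfolding eventually_at_left_field by blast
      then show ?thesis using that[of l "\<bar>y\<bar> + 1"] by (meson less_imp_le)
    qed
    define C where "C = max B (\<bar>f x\<bar> + 1)"
    have "\<bar>f s\<bar> \<le> C" if "l < s" "s < r" "0 \<le> s" for s
      using r(2)[of s] l(2)[of s] that unfolding C_def
      by (cases s x rule: linorder_cases) auto
    then have "P a b" if "a \<le> x" "x \<le> b" "b - a < min (x - l) (r - x)" for a b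
      unfolding P_def using that by (intro exI[of _ C]) auto
    then show "\<exists>d>0. \<forall>a b. a \<le> x \<and> x \<le> b \<and> b - a < d \<longrightarrow> P a b"
      using l(1) r(1) by (intro exI[of _ "min (x - l) (r - x)"]) auto
  qed fact
  then show ?thesis unfolding P_def by auto
qed

text \<open>
  The first grid point of mesh \<open>1 / Suc n\<close> strictly to the right of \<open>s\<close>, for \<open>s \<ge> 0\<close>.
\<close>
definition step_right :: "nat \<Rightarrow> real \<Rightarrow> real" where
  "step_right n s = (real (nat \<lfloor>real (Suc n) * s\<rfloor>) + 1) / real (Suc n)"

text \<open>
  Evaluation \<open>(f, s) \<mapsto> f s\<close> is not jointly measurable on the product space of all functions. For a
  right-continuous path it agrees with this limit along grids, which is.
\<close>
definition path_value :: "(real \<Rightarrow> real) \<Rightarrow> real \<Rightarrow> real" where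
  "path_value f s = lim (\<lambda>n. f (step_right n s))"

lemma step_right_nonneg: "step_right n s \<ge> 0"
  by (simp add: step_right_def)

lemma step_right_bounds:
  assumes "s \<ge> 0"
  shows "s < step_right n s" "step_right n s \<le> s + 1 / real (Suc n)"
proof -
  define k where "k = real (Suc n)"
  have k: "k > 0" by (simp add: k_def)
  have "real (nat \<lfloor>k * s\<rfloor>) = of_int \<lfloor>k * s\<rfloor>" using assms k by simp
  then have "k * s < real (nat \<lfloor>k * s\<rfloor>) + 1" "real (nat \<lfloor>k * s\<rfloor>) \<le> k * s" by linarith+
  then show "s < step_right n s" "step_right n s \<le> s + 1 / real (Suc n)"
    using k unfolding step_right_def k_def[symmetric] by (simp_all add: field_simps)
qed

lemma path_value_cadlag:
  assumes "cadlag f" "s \<ge> 0"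
  shows "path_value f s = f s"
proof -
  have "filterlim (\<lambda>n. step_right n s) (at_right s) sequentially"
    unfolding filterlim_at
  proof
    show "\<forall>\<^sub>F n in sequentially. step_right n s \<in> {s<..} \<and> step_right n s \<noteq> s"
      using step_right_bounds(1)[OF assms(2)] by (intro always_eventually allI) (metis greaterThan_iff less_irrefl)
    have "(\<lambda>n. s + 1 / real (Suc n)) \<longlonglongrightarrow> s"
      using LIMSEQ_inverse_real_of_nat_add[of s] by (simp add: inverse_eq_divide)
    then show "(\<lambda>n. step_right n s) \<longlonglongrightarrow> s"
    proof (rule tendsto_sandwich[OF _ _ tendsto_const, rotated -1])
      show "\<forall>\<^sub>F n in sequentially. s \<le> step_right n s"
        using less_imp_le[OF step_right_bounds(1)[OF assms(2)]] by simp
      show "\<forall>\<^sub>F n in sequentially. step_right n s \<le> s + 1 / real (Suc n)"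
        using step_right_bounds(2)[OF assms(2)] by simp
    qed
  qed
  moreover have "(f \<longlongrightarrow> f s) (at_right s)" using assms by (simp add: cadlag_def)
  ultimately show ?thesis
    unfolding path_value_def by (intro limI) (rule filterlim_compose)
qed

text \<open>
  Each approximation reads the path at countably many fixed times only, hence is measurable for
  the product sigma-algebra.
\<close>
lemma path_value_measurable:
  "(\<lambda>(\<omega>, s). path_value \<omega> s) \<in> borel_measurable (Pi\<^sub>M {0..} (\<lambda>_. borel) \<Otimes>\<^sub>M borel)"
proof -
  have "(\<lambda>p. fst p (step_right n (snd p))) \<in>
          borel_measurable (Pi\<^sub>M {0..} (\<lambda>_. borel :: real measure) \<Otimes>\<^sub>M borel)" for n
    unfolding step_right_def
  proof (rule measurable_compose_countable[where f="\<lambda>k p. fst p ((real k + 1) / real (Suc n))"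
        and g="\<lambda>p. nat \<lfloor>real (Suc n) * snd p\<rfloor>"])
    show "(\<lambda>p. fst p ((real k + 1) / real (Suc n))) \<in>
          borel_measurable (Pi\<^sub>M {0..} (\<lambda>_. borel) \<Otimes>\<^sub>M borel)" for k
      by (rule measurable_compose[OF measurable_fst measurable_component_singleton]) simp
  qed measurable
  then show ?thesis
    unfolding path_value_def case_prod_unfold by (rule borel_measurable_lim_metric)
qed

lemma cadlag_restrict_measurable:
  assumes "cadlag f"
  shows "(\<lambda>s. indicator {0..} s * f s) \<in> borel_measurable borel"
proof -
  let ?\<omega> = "restrict f {0..}"
  have "?\<omega> \<in> space (Pi\<^sub>M {0..} (\<lambda>_. borel))" by (auto simp: space_PiM)
  then have "(\<lambda>s. path_value ?\<omega> s) \<in> borel_measurable borel"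
    using measurable_Pair_compose_split[OF path_value_measurable, of "\<lambda>_. ?\<omega>" borel "\<lambda>s. s"] by simp
  moreover have "(\<lambda>s. indicator {0..} s * f s) = (\<lambda>s. indicator {0..} s * path_value ?\<omega> s)"
    using path_value_cadlag[OF assms]
    by (auto simp: indicator_def path_value_def step_right_nonneg fun_eq_iff)
  ultimately show ?thesis by simp
qed

lemma cadlag_set_integrable:
  assumes "cadlag f" "0 \<le> t"
  shows "set_integrable lborel {0..t} f"
proof -
  obtain B where B: "\<forall>s\<in>{0..t}. \<bar>f s\<bar> \<le> B"
    using cadlag_bounded[OF assms] ..
  have "integrable lborel (\<lambda>s. indicator {0..t} s *\<^sub>R (indicator {0..} s * f s))"
    using cadlag_restrict_measurable[OF assms(1)] B
    by (intro integrableI_bounded_set_indicator[where B=B])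
       (auto intro!: AE_I2 simp: indicator_def emeasure_lborel_Icc_eq)
  then show ?thesis
    unfolding set_integrable_def
    by (rule Bochner_Integration.integrable_cong[THEN iffD1, rotated 2]) (auto simp: indicator_def)
qed

lemma cadlag_add_continuous:
  assumes "cadlag f" "continuous_on UNIV g"
  shows "cadlag (\<lambda>s. f s + g s)"
proof -
  have g: "(g \<longlongrightarrow> g s) (at s within A)" for s A
  proof -
    have "(g \<longlongrightarrow> g s) (at s)"
      using assms(2) by (simp add: continuous_on_eq_continuous_at isCont_def)
    then show ?thesis by (rule tendsto_within_subset) simp
  qed
  show ?thesis
    unfolding cadlag_def
  proof (intro conjI allI impI)
    show "((\<lambda>s. f s + g s) \<longlongrightarrow> f t + g t) (at_right t)" if "t \<ge> 0" for t
      using assms(1) that unfolding cadlag_def by (intro tendsto_add g) simp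
    show "\<exists>l. ((\<lambda>s. f s + g s) \<longlongrightarrow> l) (at_left t)" if t: "t > 0" for t
    proof -
      obtain l where "(f \<longlongrightarrow> l) (at_left t)" using assms(1) t unfolding cadlag_def by blast
      then have "((\<lambda>s. f s + g s) \<longlongrightarrow> l + g t) (at_left t)" by (rule tendsto_add[OF _ g])
      then show ?thesis ..
    qed
  qed
qed

section \<open>Solving the equation path by path\<close>

text \<open>
  Variation of constants, arranged so that only continuous functions are differentiated. The path
  \<open>z\<close> may jump, but its second integral \<open>K\<close> is continuously differentiable with
  \<open>K' = A - b * K\<close>. Thus \<open>exp (b * s) * K s\<close> has derivative \<open>exp (b * s) * A s\<close>, and \<open>z\<close> is
  recovered from \<open>K\<close> by using the equation twice.
\<close>
lemma ou_path_variation_of_constants: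
  fixes z l :: "real \<Rightarrow> real" and b T :: real
  assumes z: "set_integrable lborel {0..T} z" and "T \<ge> 0"
    and eq: "\<And>t. t \<in> {0..T} \<Longrightarrow> z t = l t - b * (LINT s:{0..t}|lborel. z s)"
  defines "A \<equiv> \<lambda>t. LINT s:{0..t}|lborel. l s"
  shows "z T = l T - b * A T + b\<^sup>2 * exp (- b * T) * (LINT s:{0..T}|lborel. exp (b * s) * A s)"
proof -
  define J where "J t = (LINT s:{0..t}|lborel. z s)" for t
  define K where "K t = integral {0..t} J" for t
  have sub: "set_integrable lborel {0..t} z" if "t \<in> {0..T}" for t
    using set_integrable_subset[OF z, of "{0..t}"] that by auto
  have zi: "z integrable_on {0..T}" by (rule set_borel_integral_eq_integral(1)[OF z])
  have J_int: "J t = integral {0..t} z" if "t \<in> {0..T}" for t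
    unfolding J_def by (rule set_borel_integral_eq_integral(2)[OF sub[OF that]])
  have J_cont: "continuous_on {0..T} J"
    using indefinite_integral_continuous_1[OF zi] by (subst continuous_on_cong[OF refl J_int]) auto
  have J_sint: "set_integrable lborel {0..t} J" if "t \<in> {0..T}" for t
    using that by (intro borel_integrable_atLeastAtMost' continuous_on_subset[OF J_cont]) auto
  have K_J: "K t = (LINT s:{0..t}|lborel. J s)" if "t \<in> {0..T}" for t
    unfolding K_def by (rule set_borel_integral_eq_integral(2)[OF J_sint[OF that], symmetric])
  have K_deriv: "(K has_real_derivative J t) (at t within {0..T})" if "t \<in> {0..T}" for t
    using integral_has_vector_derivative[OF J_cont that]
    by (simp add: K_def[abs_def] has_real_derivative_iff_has_vector_derivative)
  have A_eq: "A t = J t + b * K t" if t: "t \<in> {0..T}" for t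
  proof -
    have "A t = (LINT s:{0..t}|lborel. z s + b * J s)"
      unfolding A_def using t by (intro set_lebesgue_integral_cong) (auto simp: eq J_def)
    also have "\<dots> = J t + b * K t"
      using set_integral_add(2)[OF sub[OF t] set_integrable_mult_right[OF J_sint[OF t], of b]] t
      by (simp add: J_def[symmetric] K_J[symmetric])
    finally show ?thesis .
  qed
  have K_cont: "continuous_on {0..T} K"
    using K_deriv by (rule DERIV_continuous_on)
  have A_cont: "continuous_on {0..T} (\<lambda>s. exp (b * s) * A s)"
  proof -
    have "continuous_on {0..T} A"
      using J_cont K_cont by (subst continuous_on_cong[OF refl A_eq]) (auto intro!: continuous_intros)
    then show ?thesis by (auto intro!: continuous_intros)
  qed
  have "(LINT s|lborel. indicator {0..T} s *\<^sub>R (exp (b * s) * A s)) = exp (b * T) * K T - exp (b * 0) * K 0"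
  proof (rule integral_FTC_atLeastAtMost)
    fix s assume "0 \<le> s" "s \<le> T"
    then have s: "s \<in> {0..T}" by simp
    have "((\<lambda>s. exp (b * s) * K s) has_real_derivative exp (b * s) * A s) (at s within {0..T})"
      by (auto intro!: derivative_eq_intros K_deriv[OF s] simp: A_eq[OF s] algebra_simps)
    then show "((\<lambda>s. exp (b * s) * K s) has_vector_derivative exp (b * s) * A s) (at s within {0..T})"
      by (simp add: has_real_derivative_iff_has_vector_derivative)
  qed (use A_cont \<open>T \<ge> 0\<close> in auto)
  then have KT: "K T = exp (- b * T) * (LINT s:{0..T}|lborel. exp (b * s) * A s)"
    by (simp add: set_lebesgue_integral_def K_def exp_minus field_simps)
  have "z T = l T - b * J T" using eq[of T] \<open>T \<ge> 0\<close> by (simp add: J_def)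
  also have "J T = A T - b * K T" using A_eq[of T] \<open>T \<ge> 0\<close> by simp
  finally show ?thesis by (simp add: KT power2_eq_square algebra_simps)
qed

text \<open>
  For a cadlag \<open>\<omega>\<close>, the value at time \<open>t\<close> of the solution starting at \<open>0\<close> and driven by \<open>\<omega>\<close>, that is,
  \<open>\<integral> exp (- b * (t - s)) d\<omega> s\<close> over \<open>{0..t}\<close>. It is written with \<open>path_value\<close> to be measurable on the
  whole product space.
\<close>
definition ou_noise :: "real \<Rightarrow> real \<Rightarrow> (real \<Rightarrow> real) \<Rightarrow> real" where
  "ou_noise b t \<omega> =
     (let l = (\<lambda>s. path_value \<omega> s - \<omega> 0); A = (\<lambda>s. LINT r:{0..s}|lborel. l r)
      in (\<omega> t - \<omega> 0) - b * A t + b\<^sup>2 * exp (- b * t) * (LINT s:{0..t}|lborel. exp (b * s) * A s))"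

lemma ou_noise_measurable:
  assumes "t \<ge> 0"
  shows "ou_noise b t \<in> borel_measurable (Pi\<^sub>M {0..} (\<lambda>_. borel))"
proof -
  let ?P = "Pi\<^sub>M {0..} (\<lambda>_. borel :: real measure)"
  have at: "(\<lambda>x. g x s) \<in> borel_measurable N" if "g \<in> measurable N ?P" "s \<ge> 0" for g s and N :: "'n measure"
    using measurable_compose[OF that(1) measurable_component_singleton[of s "{0..}"]] that(2) by simp
  have [measurable]: "(\<lambda>\<omega>. \<omega> s) \<in> borel_measurable ?P" if "s \<ge> 0" for s
    using that by (intro measurable_component_singleton) simp
  note [measurable] = this[OF assms] this[of 0, simplified]
  have val: "(\<lambda>x. path_value (g x) (h x)) \<in> borel_measurable N"
    if "g \<in> measurable N ?P" "h \<in> borel_measurable N" for g h and N :: "'n measure"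
    using measurable_Pair_compose_split[OF path_value_measurable that] .
  have int1: "(\<lambda>x. LINT r:{0..h x}|lborel. path_value (g x) r - g x 0) \<in> borel_measurable N"
    if g[measurable]: "g \<in> measurable N ?P" and [measurable]: "h \<in> borel_measurable N"
    for g h and N :: "'n measure"
  proof -
    have [measurable]: "(\<lambda>x. g x 0) \<in> borel_measurable N" by (rule at[OF g]) simp
    have [measurable]: "(\<lambda>p. path_value (g (fst p)) (snd p)) \<in> borel_measurable (N \<Otimes>\<^sub>M lborel)"
      by (rule val) measurable
    have "(\<lambda>x. LINT r|lborel. (if 0 \<le> r \<and> r \<le> h x then path_value (g x) r - g x 0 else 0)) \<in> borel_measurable N"
      by measurable
    also have "(\<lambda>x. LINT r|lborel. (if 0 \<le> r \<and> r \<le> h x then path_value (g x) r - g x 0 else 0)) =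
                 (\<lambda>x. LINT r:{0..h x}|lborel. path_value (g x) r - g x 0)"
      unfolding set_lebesgue_integral_def
      by (intro ext Bochner_Integration.integral_cong) (auto simp: indicator_def)
    finally show ?thesis .
  qed
  have [measurable]: "(\<lambda>x. LINT r:{0..t}|lborel. path_value x r - x 0) \<in> borel_measurable ?P"
    by (rule int1) auto
  have [measurable]: "(\<lambda>p. LINT r:{0..snd p}|lborel. path_value (fst p) r - fst p 0) \<in>
      borel_measurable (?P \<Otimes>\<^sub>M lborel)"
    by (rule int1) measurable
  have [measurable]: "(\<lambda>x. LINT s:{0..t}|lborel. exp (b * s) * (LINT r:{0..s}|lborel. path_value x r - x 0)) \<in>
      borel_measurable ?P"
    unfolding set_lebesgue_integral_def[of lborel "{0..t}"] by measurable
  show ?thesis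
    unfolding ou_noise_def Let_def by measurable
qed

text \<open>
  The equation is linear, and \<open>exp (- b * s) * v\<close> solves its homogeneous form. Changing the
  starting point of a given solution in this way yields both the noise part (start \<open>0\<close>) and a
  solution with stationary start, so no solution has to be constructed.
\<close>
lemma ou_path_shift:
  fixes x l :: "real \<Rightarrow> real" and b v :: real
  assumes x: "cadlag x" "\<And>t. t \<ge> 0 \<Longrightarrow> x t - x 0 = - b * (LINT s:{0..t}|lborel. x s) + l t"
  defines "y \<equiv> \<lambda>s. x s + exp (- b * s) * v"
  shows "cadlag y" "\<And>t. t \<ge> 0 \<Longrightarrow> y t - y 0 = - b * (LINT s:{0..t}|lborel. y s) + l t"
proof -
  show "cadlag y"
    unfolding y_def by (intro cadlag_add_continuous x continuous_intros)
  fix t :: real assume t: "t \<ge> 0"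
  have int_exp: "set_integrable lborel {0..t} (\<lambda>s. exp (- b * s) * v)"
    by (intro borel_integrable_atLeastAtMost' continuous_intros)
  have "(LINT s:{0..t}|lborel. - b * (exp (- b * s) * v)) = exp (- b * t) * v - exp (- b * 0) * v"
    unfolding set_lebesgue_integral_def
    by (rule integral_FTC_atLeastAtMost[where F="\<lambda>s. exp (- b * s) * v"])
       (auto intro!: derivative_eq_intros continuous_intros t simp flip: has_real_derivative_iff_has_vector_derivative)
  then have "- b * (LINT s:{0..t}|lborel. exp (- b * s) * v) = exp (- b * t) * v - v"
    by (simp only: set_integral_mult_right) simp
  then show "y t - y 0 = - b * (LINT s:{0..t}|lborel. y s) + l t"
    unfolding y_def
    using x(2)[OF t] set_integral_add(2)[OF cadlag_set_integrable[OF x(1) t] int_exp]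
    by (simp add: algebra_simps)
qed

text \<open>
  Subtracting the decaying initial value leaves a solution that starts at \<open>0\<close>, and this one is
  determined by the driving path.
\<close>
lemma ou_path_noise:
  fixes x L :: "real \<Rightarrow> real" and b t :: real
  assumes x: "cadlag x" and L: "cadlag L" and t: "t \<ge> 0"
    and eq: "\<And>t. t \<ge> 0 \<Longrightarrow> x t - x 0 = - b * (LINT s:{0..t}|lborel. x s) + (L t - L 0)"
  shows "x t = exp (- b * t) * x 0 + ou_noise b t (restrict L {0..})"
proof -
  let ?l = "\<lambda>s. L s - L 0" and ?\<omega> = "restrict L {0..}"
  define z where "z s = x s + exp (- b * s) * (- x 0)" for s
  have z: "cadlag z" "\<And>t. t \<ge> 0 \<Longrightarrow> z t - z 0 = - b * (LINT s:{0..t}|lborel. z s) + ?l t"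
    using ou_path_shift[where v="- x 0", OF x eq] unfolding z_def[abs_def] by auto
  have "z 0 = 0" by (simp add: z_def)
  then have "z t = ?l t - b * (LINT s:{0..t}|lborel. ?l s) +
      b\<^sup>2 * exp (- b * t) * (LINT s:{0..t}|lborel. exp (b * s) * (LINT r:{0..s}|lborel. ?l r))"
    using z(2) by (intro ou_path_variation_of_constants cadlag_set_integrable z t) auto
  moreover have "path_value ?\<omega> s = L s" if "s \<ge> 0" for s
    using path_value_cadlag[OF L that] by (simp add: path_value_def step_right_nonneg)
  then have "(LINT r:{0..s}|lborel. ?l r) = (LINT r:{0..s}|lborel. path_value ?\<omega> r - ?\<omega> 0)" for s
    by (intro set_lebesgue_integral_cong) auto
  ultimately have "z t = ou_noise b t ?\<omega>"
    using t by (simp add: ou_noise_def Let_def)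
  then show ?thesis by (simp add: z_def)
qed

section \<open>The law of an Ornstein-Uhlenbeck process\<close>

context
  fixes M :: "'w measure" and b :: real and L X :: "real \<Rightarrow> 'w \<Rightarrow> real" and X0 :: "'w \<Rightarrow> real"
  assumes ou: "ou_process M b L X0 X"
begin

lemma ou_prob_space: "prob_space M"
  using ou unfolding ou_process_def levy_process_def by blast

lemma ou_driver_measurable:
  "(\<lambda>w. restrict (\<lambda>s. L s w) {0..}) \<in> measurable M (Pi\<^sub>M {0..} (\<lambda>_. borel))"
  using ou unfolding ou_process_def levy_process_def by (intro measurable_restrict) auto

abbreviation "noise t w \<equiv> ou_noise b t (restrict (\<lambda>s. L s w) {0..})"

lemma ou_paths:
  "AE w in M. cadlag (\<lambda>s. L s w) \<and> cadlag (\<lambda>s. X s w) \<and> X 0 w = X0 w \<and>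
     (\<forall>t\<ge>0. X t w - X 0 w = - b * (LINT s:{0..t}|lborel. X s w) + (L t w - L 0 w))"
  using ou unfolding ou_process_def levy_process_def ou_solution_def by (auto simp: AE_conj_iff)

lemma noise_measurable: "t \<ge> 0 \<Longrightarrow> noise t \<in> borel_measurable M"
  using measurable_compose[OF ou_driver_measurable ou_noise_measurable] .

text \<open>
  \<open>X t = exp (- b * t) * X0 + Z\<close>, and the noise \<open>Z\<close> is independent of \<open>X0\<close> because it is a
  measurable function of the restricted path of \<open>L\<close>.
\<close>
lemma char_ou_process:
  assumes t: "t \<ge> 0"
  shows "char (distr M borel (X t)) u =
           char (distr M borel X0) (exp (- b * t) * u) * char (distr M borel (noise t)) u"
proof -
  interpret prob_space M by (rule ou_prob_space)
  have [measurable]: "X0 \<in> borel_measurable M" "X t \<in> borel_measurable M"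
    using ou t unfolding ou_process_def ou_solution_def by auto
  note [measurable] = noise_measurable[OF t]
  have "indep_rv M borel X0 (Pi\<^sub>M {0..} (\<lambda>_. borel)) (\<lambda>w. restrict (\<lambda>s. L s w) {0..})"
    using ou unfolding ou_process_def by blast
  then have indep: "indep_var borel (\<lambda>w. X0 w * exp (- b * t)) borel (noise t)"
    by (intro indep_var_iff_indep_rv[THEN iffD2]
          indep_rv_compose[OF _ _ ou_driver_measurable _ ou_noise_measurable[OF t]]) measurable
  have "AE w in M. X t w = X0 w * exp (- b * t) + noise t w"
    using ou_paths by eventually_elim (metis ou_path_noise[OF _ _ t] mult.commute)
  then have "distr M borel (X t) = distr M borel (\<lambda>w. X0 w * exp (- b * t) + noise t w)"
    by (intro distr_cong_AE) auto
  then show ?thesis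
    by (simp only: char_distr_add[OF indep] char_distr_scale[OF \<open>X0 \<in> borel_measurable M\<close>])
qed

text \<open>
  Stationarity speaks of solutions on \<open>\<mu> \<Otimes>\<^sub>M M\<close> whose start is the first coordinate. Shifting
  the given \<open>X\<close> along the homogeneous solution provides one, with the same noise as \<open>X\<close>.
\<close>
lemma char_ou_stationary_law:
  assumes t: "t \<ge> 0" and stat: "ou_stationary_law M b L \<mu>"
  shows "char \<mu> u = char \<mu> (exp (- b * t) * u) * char (distr M borel (noise t)) u"
proof -
  interpret prob_space M by (rule ou_prob_space)
  interpret \<mu>: real_distribution \<mu> using stat by (simp add: ou_stationary_law_def)
  interpret \<mu>M: prob_space "\<mu> \<Otimes>\<^sub>M M" by (rule prob_space_pair) unfold_locales
  have [measurable]: "X s \<in> borel_measurable M" if "s \<ge> 0" for s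
    using ou that unfolding ou_process_def ou_solution_def by auto
  note [measurable] = this[OF t] this[of 0, simplified] noise_measurable[OF t]
  define Y where "Y s p = X s (snd p) + exp (- b * s) * (fst p - X 0 (snd p))" for s p
  have Y_meas: "Y s \<in> borel_measurable (\<mu> \<Otimes>\<^sub>M M)" if "s \<ge> 0" for s
  proof -
    have [measurable]: "X s \<in> borel_measurable M" using that by fact
    show ?thesis unfolding Y_def by measurable
  qed
  have paths: "AE p in \<mu> \<Otimes>\<^sub>M M. cadlag (\<lambda>s. L s (snd p)) \<and> cadlag (\<lambda>s. X s (snd p)) \<and> X 0 (snd p) = X0 (snd p) \<and>
     (\<forall>t\<ge>0. X t (snd p) - X 0 (snd p) =
        - b * (LINT s:{0..t}|lborel. X s (snd p)) + (L t (snd p) - L 0 (snd p)))"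
  proof (rule AE_distrD[where f=snd and M'=M])
    show "AE w in distr (\<mu> \<Otimes>\<^sub>M M) M snd. cadlag (\<lambda>s. L s w) \<and> cadlag (\<lambda>s. X s w) \<and> X 0 w = X0 w \<and>
        (\<forall>t\<ge>0. X t w - X 0 w = - b * (LINT s:{0..t}|lborel. X s w) + (L t w - L 0 w))"
      unfolding distr_pair_snd[OF \<mu>.prob_space_axioms prob_space_axioms] by (rule ou_paths)
  qed measurable
  have Y_paths: "AE p in \<mu> \<Otimes>\<^sub>M M. cadlag (\<lambda>s. Y s p) \<and> Y 0 p = fst p \<and>
     (\<forall>t\<ge>0. Y t p - Y 0 p = - b * (LINT s:{0..t}|lborel. Y s p) + (L t (snd p) - L 0 (snd p)))"
    using paths
  proof eventually_elim
    case (elim p)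
    then have "cadlag (\<lambda>s. X s (snd p))"
      "\<And>t. t \<ge> 0 \<Longrightarrow> X t (snd p) - X 0 (snd p) =
          - b * (LINT s:{0..t}|lborel. X s (snd p)) + (L t (snd p) - L 0 (snd p))" by auto
    from ou_path_shift[where v="fst p - X 0 (snd p)", OF this] show ?case
      by (simp add: Y_def)
  qed
  then have "ou_solution (\<mu> \<Otimes>\<^sub>M M) b (\<lambda>t w. L t (snd w)) fst Y"
    unfolding ou_solution_def using Y_meas by (auto simp: AE_conj_iff)
  then have "\<mu> = distr (\<mu> \<Otimes>\<^sub>M M) borel (Y t)"
    using stat t unfolding ou_stationary_law_def by simp
  also have "\<dots> = distr (\<mu> \<Otimes>\<^sub>M M) borel (\<lambda>p. fst p * exp (- b * t) + noise t (snd p))"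
  proof (rule distr_cong_AE)
    show "AE p in \<mu> \<Otimes>\<^sub>M M. Y t p = fst p * exp (- b * t) + noise t (snd p)"
      using paths Y_paths
    proof eventually_elim
      case (elim p)
      then have "Y t p = exp (- b * t) * Y 0 p + noise t (snd p)"
        by (intro ou_path_noise t) auto
      with elim show ?case by (simp add: mult.commute)
    qed
  qed (use Y_meas[OF t] in auto)
  finally have "char \<mu> u = char (distr (\<mu> \<Otimes>\<^sub>M M) borel (\<lambda>p. fst p * exp (- b * t) + noise t (snd p))) u"
    by simp
  also have "\<dots> = char (distr \<mu> borel (\<lambda>x. x * exp (- b * t))) u * char (distr M borel (noise t)) u"
    by (rule char_pair_add) (auto simp: prob_space_axioms \<mu>.prob_space_axioms)
  also have "char (distr \<mu> borel (\<lambda>x. x * exp (- b * t))) u = char \<mu> (exp (- b * t) * u)"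
    by (simp add: char_def integral_distr mult_ac)
  finally show ?thesis .
qed

end

section \<open>Realising the summands on a product space\<close>

lemma compound_poisson_sum_measurable:
  fixes J :: "nat \<Rightarrow> 'v \<Rightarrow> real"
  assumes "compound_poisson_data N \<Lambda> f K J"
  shows "(\<lambda>w. \<Sum>i<K w. J i w) \<in> borel_measurable N"
proof (rule measurable_compose_countable[where f="\<lambda>k w. \<Sum>i<k. J i w" and g=K])
  have "J i \<in> borel_measurable N" for i
    using assms distributed_measurable[of N lborel "J i" "\<lambda>x. ennreal (f x)"]
    by (simp add: compound_poisson_data_def)
  then show "(\<lambda>w. \<Sum>i<k. J i w) \<in> borel_measurable N" for k by simp
  show "K \<in> measurable N (count_space UNIV)"
    using assms by (simp add: compound_poisson_data_def)
qed

text \<open>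
  On the sequence space, coordinates 0 and 1 carry the two given laws, coordinate 2 the Poisson
  number (as a real), and the coordinates from 3 on the jumps. Disjoint blocks of coordinates are
  independent.
\<close>
lemma product_realisation:
  fixes \<rho>0 \<rho>1 :: "real measure" and f :: "real \<Rightarrow> real" and a \<Lambda> :: real
  assumes \<rho>0: "real_distribution \<rho>0" and \<rho>1: "real_distribution \<rho>1" and "\<Lambda> > 0"
    and f[measurable]: "f \<in> borel_measurable borel" and f1: "(\<integral>\<^sup>+x. ennreal (f x) \<partial>lborel) = 1"
  shows "\<exists>(N :: (nat \<Rightarrow> real) measure) Y0 Y1 K J.
           prob_space N \<and> Y0 \<in> borel_measurable N \<and> Y1 \<in> borel_measurable N \<and>
           distr N borel Y0 = \<rho>0 \<and> distr N borel Y1 = \<rho>1 \<and>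
           compound_poisson_data N \<Lambda> f K J \<and>
           prob_space.indep_vars N (\<lambda>_. borel) (\<lambda>i. [\<lambda>w. Y0 w * a, Y1, \<lambda>w. \<Sum>i<K w. J i w] ! i) {..<3}"
proof -
  interpret \<rho>0: real_distribution \<rho>0 by fact
  interpret \<rho>1: real_distribution \<rho>1 by fact
  define m where "m i = (if i = 0 then \<rho>0 else if i = 1 then \<rho>1
     else if i = 2 then distr (measure_pmf (poisson_pmf \<Lambda>)) borel real
     else density lborel (\<lambda>x. ennreal (f x)))" for i :: nat
  have "prob_space (distr (measure_pmf (poisson_pmf \<Lambda>)) borel real)"
    by (rule measure_pmf.prob_space_distr) simp
  moreover have "prob_space (density lborel (\<lambda>x. ennreal (f x)))"
    by (rule prob_spaceI) (simp add: emeasure_density f1)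
  ultimately have m_prob: "prob_space (m i)" for i
    by (simp add: m_def \<rho>0.prob_space_axioms \<rho>1.prob_space_axioms)
  have m_sets[measurable_cong]: "sets (m i) = sets borel" for i by (simp add: m_def)
  define N where "N = Pi\<^sub>M UNIV m"
  interpret prob_space N unfolding N_def by (rule prob_space_PiM) (rule m_prob)
  have N_sets: "sets N = sets (Pi\<^sub>M UNIV (\<lambda>_. borel))"
    unfolding N_def by (rule sets_PiM_cong) (simp_all add: m_sets)
  have coord[measurable]: "(\<lambda>w. w i) \<in> borel_measurable N" for i
    unfolding measurable_cong_sets[OF N_sets refl] by simp
  have coord_law: "distr N borel (\<lambda>w. w i) = m i" for i
    using distr_PiM_component[of UNIV m i] m_prob by (simp add: N_def m_sets cong: distr_cong)
  have indep: "indep_vars (\<lambda>_. borel) (\<lambda>i w. w i) UNIV"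
  proof (subst indep_vars_iff_distr_eq_PiM')
    have "distr N (Pi\<^sub>M UNIV (\<lambda>_. borel)) (\<lambda>w. \<lambda>i\<in>UNIV. w i) = N"
      by (simp add: restrict_UNIV distr_id2 N_sets)
    then show "distr N (Pi\<^sub>M UNIV (\<lambda>_. borel)) (\<lambda>w. \<lambda>i\<in>UNIV. w i) =
                 (\<Pi>\<^sub>M i\<in>UNIV. distr N borel (\<lambda>w. w i))"
      by (simp only: coord_law N_def[symmetric])
  qed auto
  define K where "K w = nat \<lfloor>w 2\<rfloor>" for w :: "nat \<Rightarrow> real"
  define J where "J i w = w (i + 3)" for i and w :: "nat \<Rightarrow> real"
  have K[measurable]: "K \<in> measurable N (count_space UNIV)" unfolding K_def by measurable
  have J[measurable]: "J i \<in> borel_measurable N" for i unfolding J_def by measurable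
  have "distr N (count_space UNIV) K = distr (distr N borel (\<lambda>w. w 2)) (count_space UNIV) (\<lambda>x. nat \<lfloor>x\<rfloor>)"
    by (subst distr_distr) (auto simp: comp_def K_def[abs_def])
  also have "\<dots> = distr (measure_pmf (poisson_pmf \<Lambda>)) (count_space UNIV) (\<lambda>k. k)"
    unfolding coord_law m_def by (simp add: distr_distr comp_def)
  finally have K_law: "distr N (count_space UNIV) K = measure_pmf (poisson_pmf \<Lambda>)"
    by (simp add: distr_id2)
  have J_law: "distributed N lborel (J i) (\<lambda>x. ennreal (f x))" for i
    using coord_law[of "i + 3"] J[of i]
    by (auto simp: distributed_def m_def J_def[abs_def] cong: distr_cong)
  have J_indep: "indep_vars (\<lambda>_. borel) J UNIV"
  proof -
    have "indep_vars (\<lambda>j. Pi\<^sub>M {j + 3} (\<lambda>_. borel)) (\<lambda>j w. restrict w {j + 3}) (UNIV :: nat set)"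
      by (rule indep_vars_restrict[OF indep]) (auto simp: disjoint_family_on_def)
    then have "indep_vars (\<lambda>_. borel) (\<lambda>j w. (\<lambda>v. v (j + 3)) (restrict w {j + 3})) (UNIV :: nat set)"
      by (rule indep_vars_compose2) (rule measurable_component_singleton, simp)
    then show ?thesis by (simp add: J_def[abs_def])
  qed
  have KJ_indep: "indep_rv N (count_space UNIV) K (Pi\<^sub>M UNIV (\<lambda>_. borel)) (\<lambda>w i. J i w)"
  proof -
    have "indep_var (Pi\<^sub>M {2} (\<lambda>_. borel)) (\<lambda>w. restrict w {2}) (Pi\<^sub>M {3..} (\<lambda>_. borel)) (\<lambda>w. restrict w {3..})"
      by (rule indep_var_restrict[OF indep]) auto
    moreover have rv: "(\<lambda>w. restrict w A) \<in> measurable N (Pi\<^sub>M A (\<lambda>_. borel))" for A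
      by (rule measurable_restrict) simp
    ultimately have "indep_rv N (Pi\<^sub>M {2} (\<lambda>_. borel)) (\<lambda>w. restrict w {2}) (Pi\<^sub>M {3..} (\<lambda>_. borel)) (\<lambda>w. restrict w {3..})"
      using indep_var_iff_indep_rv by blast
    then have "indep_rv N (count_space UNIV) (\<lambda>w. (\<lambda>v. nat \<lfloor>v 2\<rfloor>) (restrict w {2}))
        (Pi\<^sub>M UNIV (\<lambda>_. borel)) (\<lambda>w. (\<lambda>v i. v (i + 3)) (restrict w {3..}))"
    proof (rule indep_rv_compose[OF _ rv rv])
      have [measurable]: "(\<lambda>v. v 2) \<in> borel_measurable (Pi\<^sub>M {2 :: nat} (\<lambda>_. borel :: real measure))"
        by (rule measurable_component_singleton) simp
      show "(\<lambda>v :: nat \<Rightarrow> real. nat \<lfloor>v 2\<rfloor>) \<in> measurable (Pi\<^sub>M {2} (\<lambda>_. borel)) (count_space UNIV)"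
        by measurable
      show "(\<lambda>v i. v (i + 3)) \<in> measurable (Pi\<^sub>M {3..} (\<lambda>_. borel :: real measure)) (Pi\<^sub>M (UNIV :: nat set) (\<lambda>_. borel))"
        by (intro measurable_abs_UNIV measurable_component_singleton) simp
    qed
    then show ?thesis by (simp add: K_def[abs_def] J_def)
  qed
  have data: "compound_poisson_data N \<Lambda> f K J"
    unfolding compound_poisson_data_def using K K_law J_law J_indep KJ_indep by blast
  define B where "B j = (if j = 2 then {2..} else {j})" for j :: nat
  define h where "h j v = (if j = 0 then v 0 * a else if j = 1 then v 1 else \<Sum>i<nat \<lfloor>v 2\<rfloor>. v (i + 3))"
    for j :: nat and v :: "nat \<Rightarrow> real"
  have "indep_vars (\<lambda>j. Pi\<^sub>M (B j) (\<lambda>_. borel)) (\<lambda>j w. restrict w (B j)) {..<3}"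
    by (rule indep_vars_restrict[OF indep]) (auto simp: disjoint_family_on_def B_def)
  then have "indep_vars (\<lambda>_. borel) (\<lambda>j w. h j (restrict w (B j))) {..<3}"
  proof (rule indep_vars_compose2)
    fix j :: nat assume "j \<in> {..<3}"
    have comp[measurable]: "(\<lambda>v. v i) \<in> borel_measurable (Pi\<^sub>M (B j) (\<lambda>_. borel :: real measure))" if "i \<in> B j" for i
      using that by (rule measurable_component_singleton)
    consider "j = 0" | "j = 1" | "j = 2" using \<open>j \<in> {..<3}\<close> by fastforce
    then show "h j \<in> borel_measurable (Pi\<^sub>M (B j) (\<lambda>_. borel))"
    proof cases
      case 3
      have [measurable]: "(\<lambda>v. v 2) \<in> borel_measurable (Pi\<^sub>M (B j) (\<lambda>_. borel :: real measure))"
        by (rule comp) (simp add: B_def 3)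
      have "(\<lambda>v. \<Sum>i<nat \<lfloor>v 2\<rfloor>. v (i + 3)) \<in> borel_measurable (Pi\<^sub>M (B j) (\<lambda>_. borel :: real measure))"
      proof (rule measurable_compose_countable[where f="\<lambda>k v. \<Sum>i<k. v (i + 3)"])
        show "(\<lambda>v. \<Sum>i<k. v (i + 3)) \<in> borel_measurable (Pi\<^sub>M (B j) (\<lambda>_. borel :: real measure))" for k
          by (intro borel_measurable_sum comp) (simp add: B_def 3)
      qed measurable
      then show ?thesis by (simp add: h_def[abs_def] 3)
    qed (use comp in \<open>simp_all add: h_def[abs_def] B_def\<close>)
  qed
  also have "?this \<longleftrightarrow> indep_vars (\<lambda>_. borel)
      (\<lambda>i. [\<lambda>w. w 0 * a, \<lambda>w. w 1, \<lambda>w. \<Sum>i<K w. J i w] ! i) {..<3}"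
  proof (rule indep_vars_cong[OF refl])
    fix j :: nat assume "j \<in> {..<3}"
    then consider "j = 0" | "j = 1" | "j = 2" by fastforce
    then show "(\<lambda>w. h j (restrict w (B j))) = [\<lambda>w. w 0 * a, \<lambda>w. w 1, \<lambda>w. \<Sum>i<K w. J i w] ! j"
      by cases (auto simp: h_def B_def K_def J_def)
  qed simp
  finally have indep3: "indep_vars (\<lambda>_. borel)
      (\<lambda>i. [\<lambda>w. w 0 * a, \<lambda>w. w 1, \<lambda>w. \<Sum>i<K w. J i w] ! i) {..<3}" .
  have "prob_space N" by (rule prob_space_axioms)
  moreover have "distr N borel (\<lambda>w. w 0) = \<rho>0" "distr N borel (\<lambda>w. w 1) = \<rho>1"
    by (simp_all add: coord_law m_def)
  ultimately show ?thesis
    using data indep3 coord[of 0] coord[of 1] by blast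
qed

section \<open>Decomposition of the tempered stable law\<close>

text \<open>
  Convolving copies of \<open>\<mu>\<close> raises the intensity, whereas a law with a smaller one is wanted.
  For \<open>\<alpha> > 0\<close>, scaling by \<open>\<kappa>\<close> lowers the intensity but strengthens the tempering to \<open>\<beta> / \<kappa>\<close>; adding the
  compound Poisson part for \<open>\<kappa>\<close> restores \<open>\<beta>\<close>.
\<close>
lemma cts_law_scaled_intensity:
  assumes \<mu>: "cts_law \<alpha> \<beta> c \<mu>" and "0 \<le> \<alpha>" "\<alpha> < 1" "\<beta> > 0" "c > 0" and \<kappa>: "0 < \<kappa>" "\<kappa> < 1"
  shows "\<exists>\<mu>'. cts_law \<alpha> \<beta> (c * \<kappa> powr \<alpha>) \<mu>'"
proof -
  let ?\<Lambda> = "jump_intensity \<alpha> \<beta> c \<kappa>" and ?f = "jump_density \<alpha> \<beta> \<kappa>"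
  have rd: "real_distribution \<mu>" using \<mu> by (simp add: cts_law_def)
  have pos: "?\<Lambda> > 0" using assms by (intro jump_intensity_pos)
  obtain N :: "(nat \<Rightarrow> real) measure" and Y0 Y1 K J where N: "prob_space N"
    and Y0: "Y0 \<in> borel_measurable N" "distr N borel Y0 = \<mu>"
    and data: "compound_poisson_data N ?\<Lambda> ?f K J"
    and indep: "prob_space.indep_vars N (\<lambda>_. borel) (\<lambda>i. [\<lambda>w. Y0 w * \<kappa>, Y1, \<lambda>w. \<Sum>i<K w. J i w] ! i) {..<3}"
    using product_realisation[where a=\<kappa>, OF rd rd pos jump_density_measurable nn_integral_jump_density] assms
    by blast
  interpret prob_space N by fact
  let ?S = "\<lambda>w. \<Sum>i<K w. J i w"
  \<comment> \<open>Entry 1 of the triple is left out: only the scaled variable and the compound Poisson sum are added.\<close>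
  let ?Z = "\<lambda>w. \<Sum>i\<in>{0, 2}. ([\<lambda>w. Y0 w * \<kappa>, Y1, ?S] ! i) w"
  have [measurable]: "?S \<in> borel_measurable N" by (rule compound_poisson_sum_measurable[OF data])
  note [measurable] = Y0(1)
  have "char (distr N borel ?Z) u = exp (cts_exponent \<alpha> \<beta> (c * \<kappa> powr \<alpha>) u)" for u
  proof -
    have "char (distr N borel ?Z) u = char (distr N borel (\<lambda>w. Y0 w * \<kappa>)) u * char (distr N borel ?S) u"
      by (subst char_distr_sum[OF indep_vars_subset[OF indep]]) auto
    also have "char (distr N borel (\<lambda>w. Y0 w * \<kappa>)) u = exp (cts_exponent \<alpha> \<beta> c (\<kappa> * u))"
      using Y0 \<mu> by (simp add: char_distr_scale cts_law_iff)
    also have "char (distr N borel ?S) u = exp (of_real ?\<Lambda> * (char (density lborel (\<lambda>x. ennreal (?f x))) u - 1))"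
      by (rule char_compound_poisson[OF N data pos])
    finally show ?thesis
      using assms by (simp add: cts_exponent_decomposition exp_add)
  qed
  then have "cts_law \<alpha> \<beta> (c * \<kappa> powr \<alpha>) (distr N borel ?Z)"
    unfolding cts_law_iff by (auto intro!: real_distribution_distr)
  then show ?thesis ..
qed

lemma cts_law_zero: "cts_law \<alpha> \<beta> 0 (return borel 0)"
proof -
  have "real_distribution (return borel 0)"
    by (simp add: real_distribution_def real_distribution_axioms_def prob_space_return)
  moreover have "cts_exponent \<alpha> \<beta> 0 u = 0" for u
    by (simp add: cts_exponent_def cts_levy_density_def set_lebesgue_integral_def cong: if_cong)
  ultimately show ?thesis
    by (simp add: cts_law_iff char_def integral_return)
qed

text \<open>
  Solve \<open>\<kappa> powr \<alpha> = 1 - a powr \<alpha>\<close>. For \<open>\<alpha> = 0\<close> the remaining intensity is \<open>0\<close> and the law is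
  degenerate.
\<close>
lemma cts_law_remaining_intensity:
  assumes "cts_law \<alpha> \<beta> c \<mu>" "0 \<le> \<alpha>" "\<alpha> < 1" "\<beta> > 0" "c > 0" and a: "0 < a" "a < 1"
  shows "\<exists>\<mu>'. cts_law \<alpha> \<beta> (c * (1 - a powr \<alpha>)) \<mu>'"
proof (cases "\<alpha> = 0")
  case True
  then show ?thesis using cts_law_zero[of \<alpha> \<beta>] a by auto
next
  case False
  define \<kappa> where "\<kappa> = (1 - a powr \<alpha>) powr (1 / \<alpha>)"
  have "0 < a powr \<alpha>" "a powr \<alpha> < 1"
    using a False assms(2) by (auto simp: powr01_less_one)
  then have "0 < \<kappa>" "\<kappa> < 1" "\<kappa> powr \<alpha> = 1 - a powr \<alpha>"
    using False assms(2) by (auto simp: \<kappa>_def powr_powr powr01_less_one)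
  then show ?thesis
    using cts_law_scaled_intensity[OF assms(1-5), of \<kappa>] by simp
qed

text \<open>
  Split \<open>c = c * (1 - a powr \<alpha>) + c * a powr \<alpha>\<close>: the first part is the law of \<open>X1\<close>, the
  second one differs from \<open>a\<close> times \<open>CTS(\<alpha>, \<beta>, c)\<close> by the compound Poisson part.
\<close>
lemma char_cts_ou_summands:
  assumes summands: "cts_ou_summands \<rho> a \<alpha> \<beta> c N Y0 X1 X2 K J"
    and "0 \<le> \<alpha>" "\<alpha> < 1" "\<beta> > 0" "c > 0" "0 < a" "a < 1"
  shows "char (distr N borel (\<lambda>w. Y0 w * a + X1 w + X2 w)) u =
           char \<rho> (a * u) * exp (cts_exponent \<alpha> \<beta> c u - cts_exponent \<alpha> \<beta> c (a * u))"
proof -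
  interpret prob_space N using summands by (simp add: cts_ou_summands_def)
  let ?\<Lambda> = "jump_intensity \<alpha> \<beta> c a" and ?f = "jump_density \<alpha> \<beta> a"
  have Y0: "Y0 \<in> borel_measurable N" "distr N borel Y0 = \<rho>"
    and X1: "cts_law \<alpha> \<beta> (c * (1 - a powr \<alpha>)) (distr N borel X1)"
    and X2: "distr N borel X2 = distr N borel (\<lambda>w. \<Sum>i<K w. J i w)"
    and data: "compound_poisson_data N ?\<Lambda> ?f K J"
    and indep: "indep_vars (\<lambda>_. borel) (\<lambda>i. [\<lambda>w. Y0 w * a, X1, X2] ! i) {..<3}"
    using summands by (auto simp: cts_ou_summands_def)
  have three: "{..<3} = {0, 1, 2 :: nat}" by auto
  have "char (distr N borel (\<lambda>w. \<Sum>i\<in>{..<3}. ([\<lambda>w. Y0 w * a, X1, X2] ! i) w)) u =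
          (\<Prod>i\<in>{..<3}. char (distr N borel ([\<lambda>w. Y0 w * a, X1, X2] ! i)) u)"
    by (rule char_distr_sum[OF indep])
  then have "char (distr N borel (\<lambda>w. Y0 w * a + X1 w + X2 w)) u =
          char (distr N borel (\<lambda>w. Y0 w * a)) u * char (distr N borel X1) u * char (distr N borel X2) u"
    unfolding three by (simp add: add.assoc mult.assoc)
  also have "char (distr N borel (\<lambda>w. Y0 w * a)) u = char \<rho> (a * u)"
    using Y0 by (simp add: char_distr_scale)
  also have "char (distr N borel X1) u = exp (cts_exponent \<alpha> \<beta> (c * (1 - a powr \<alpha>)) u)"
    using X1 by (simp add: cts_law_iff)
  also have "char (distr N borel X2) u =
      exp (of_real ?\<Lambda> * (char (density lborel (\<lambda>x. ennreal (?f x))) u - 1))"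
    unfolding X2 using assms by (intro char_compound_poisson[OF prob_space_axioms data] jump_intensity_pos)
  also have "of_real ?\<Lambda> * (char (density lborel (\<lambda>x. ennreal (?f x))) u - 1) =
      cts_exponent \<alpha> \<beta> (c * a powr \<alpha>) u - cts_exponent \<alpha> \<beta> c (a * u)"
    using assms by (simp add: cts_exponent_decomposition)
  also have "char \<rho> (a * u) * exp (cts_exponent \<alpha> \<beta> (c * (1 - a powr \<alpha>)) u) *
        exp (cts_exponent \<alpha> \<beta> (c * a powr \<alpha>) u - cts_exponent \<alpha> \<beta> c (a * u)) =
      char \<rho> (a * u) * exp (cts_exponent \<alpha> \<beta> c u - cts_exponent \<alpha> \<beta> c (a * u))"
    using cts_exponent_add[of \<alpha> \<beta> "c * (1 - a powr \<alpha>)" "c * a powr \<alpha>" u] assms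
    by (simp add: mult.assoc mult_exp_exp algebra_simps)
  finally show ?thesis .
qed

section \<open>The law of the process\<close>

text \<open>
  Stationarity fixes the characteristic function of the noise as a quotient of two values of
  \<open>char \<mu>\<close>, and the summands \<open>X1 + X2\<close> have the same one.
\<close>
lemma ou_process_eq_summands:
  assumes b: "b > 0" and \<alpha>: "0 \<le> \<alpha>" "\<alpha> < 1" and "\<beta> > 0" "c > 0" "t > 0"
    and ou: "ou_process M b L X0 X"
    and \<mu>: "cts_law \<alpha> \<beta> c \<mu>" "ou_stationary_law M b L \<mu>"
    and summands: "cts_ou_summands (distr M borel X0) (exp (- b * t)) \<alpha> \<beta> c N Y0 X1 X2 K J"
  shows "distr M borel (X t) = distr N borel (\<lambda>w. Y0 w * exp (- b * t) + X1 w + X2 w)"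
proof (rule Levy_uniqueness)
  let ?a = "exp (- b * t)"
  have a: "0 < ?a" "?a < 1" using assms by simp_all
  interpret M: prob_space M by (rule ou_prob_space[OF ou])
  interpret N: prob_space N using summands by (simp add: cts_ou_summands_def)
  have [measurable]: "X t \<in> borel_measurable M"
    using ou assms by (simp add: ou_process_def ou_solution_def)
  have [measurable]: "Y0 \<in> borel_measurable N" "X1 \<in> borel_measurable N" "X2 \<in> borel_measurable N"
    using summands by (simp_all add: cts_ou_summands_def)
  show "real_distribution (distr M borel (X t))" by simp
  show "real_distribution (distr N borel (\<lambda>w. Y0 w * ?a + X1 w + X2 w))" by simp
  show "char (distr M borel (X t)) = char (distr N borel (\<lambda>w. Y0 w * ?a + X1 w + X2 w))"
  proof
    fix u
    let ?\<nu> = "distr M borel (\<lambda>w. ou_noise b t (restrict (\<lambda>s. L s w) {0..}))"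
    \<comment> \<open>The division below is legitimate since \<open>char \<mu>\<close>, an exponential, has no zeros.\<close>
    have "exp (cts_exponent \<alpha> \<beta> c u) = exp (cts_exponent \<alpha> \<beta> c (?a * u)) * char ?\<nu> u"
      using char_ou_stationary_law[OF ou _ \<mu>(2), of t u] \<mu>(1) \<open>t > 0\<close> by (simp add: cts_law_iff)
    then have "char ?\<nu> u = exp (cts_exponent \<alpha> \<beta> c u - cts_exponent \<alpha> \<beta> c (?a * u))"
      by (simp add: exp_diff)
    then show "char (distr M borel (X t)) u = char (distr N borel (\<lambda>w. Y0 w * ?a + X1 w + X2 w)) u"
      using char_ou_process[OF ou, of t u] char_cts_ou_summands[OF summands, of u] assms a by simp
  qed
qed

theorem proposition4p1:
  fixes M :: "'w measure"
    and L X :: "real \<Rightarrow> 'w \<Rightarrow> real"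
    and X0 :: "'w \<Rightarrow> real"
    and b \<alpha> \<beta> c t a :: real
  assumes "b > 0" and "0 \<le> \<alpha>" and "\<alpha> < 1" and "\<beta> > 0" and "c > 0"
    and "cts_ou_process M b \<alpha> \<beta> c L X0 X"
    and "t > 0" and "a = exp (- b * t)"
  shows "(\<exists>(N :: (nat \<Rightarrow> real) measure) Y0 X1 X2 K J.
            cts_ou_summands (distr M borel X0) a \<alpha> \<beta> c N Y0 X1 X2 K J \<and>
            distr M borel (X t) = distr N borel (\<lambda>w. Y0 w * exp (- b * t) + X1 w + X2 w))
       \<and> (\<forall>(N :: 'v measure) Y0 X1 X2 K J.
            cts_ou_summands (distr M borel X0) a \<alpha> \<beta> c N Y0 X1 X2 K J \<longrightarrow>
            distr M borel (X t) = distr N borel (\<lambda>w. Y0 w * exp (- b * t) + X1 w + X2 w))"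
proof -
  obtain \<mu> where ou: "ou_process M b L X0 X"
    and \<mu>: "cts_law \<alpha> \<beta> c \<mu>" "ou_stationary_law M b L \<mu>"
    using assms(6) unfolding cts_ou_process_def by blast
  note law = ou_process_eq_summands[OF assms(1-5,7) ou \<mu>, folded assms(8)]
  have a: "0 < a" "a < 1" using assms by simp_all
  interpret M: prob_space M by (rule ou_prob_space[OF ou])
  obtain \<mu>' where \<mu>': "cts_law \<alpha> \<beta> (c * (1 - a powr \<alpha>)) \<mu>'"
    using cts_law_remaining_intensity[OF \<mu>(1) assms(2-5) a] ..
  have X0: "real_distribution (distr M borel X0)" and rd': "real_distribution \<mu>'"
    using ou \<mu>' by (simp_all add: ou_process_def cts_law_def)
  obtain N :: "(nat \<Rightarrow> real) measure" and Y0 X1 K J where N: "prob_space N"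
    and rv: "Y0 \<in> borel_measurable N" "X1 \<in> borel_measurable N"
    and laws: "distr N borel Y0 = distr M borel X0" "distr N borel X1 = \<mu>'"
    and data: "compound_poisson_data N (jump_intensity \<alpha> \<beta> c a) (jump_density \<alpha> \<beta> a) K J"
    and indep: "prob_space.indep_vars N (\<lambda>_. borel)
        (\<lambda>i. [\<lambda>w. Y0 w * a, X1, \<lambda>w. \<Sum>i<K w. J i w] ! i) {..<3}"
    using product_realisation[where a=a, OF X0 rd' jump_intensity_pos[OF a assms(2-5)]
        jump_density_measurable[OF a assms(2-4)] nn_integral_jump_density[OF a assms(2-4)]]
    by blast
  then have summands: "cts_ou_summands (distr M borel X0) a \<alpha> \<beta> c N Y0 X1 (\<lambda>w. \<Sum>i<K w. J i w) K J"
    using \<mu>' compound_poisson_sum_measurable[OF data] by (simp add: cts_ou_summands_def)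
  show ?thesis
    unfolding assms(8)[symmetric]
  proof (intro conjI)
    show "\<exists>(N :: (nat \<Rightarrow> real) measure) Y0 X1 X2 K J.
        cts_ou_summands (distr M borel X0) a \<alpha> \<beta> c N Y0 X1 X2 K J \<and>
        distr M borel (X t) = distr N borel (\<lambda>w. Y0 w * a + X1 w + X2 w)"
      using summands law[OF summands] by blast
    show "\<forall>(N :: 'v measure) Y0 X1 X2 K J.
        cts_ou_summands (distr M borel X0) a \<alpha> \<beta> c N Y0 X1 X2 K J \<longrightarrow>
        distr M borel (X t) = distr N borel (\<lambda>w. Y0 w * a + X1 w + X2 w)"
      using law by blast
  qed
qed

end
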